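(* There is a uniformly discrete set $\Lambda\subset\mathbb{R}$ with uniform density $D(\Lambda)=1$ such that, for every $0<\delta<1$, $\Lambda$ is a uniqueness set for $X_S$ with $S=[0,1-\delta]+\mathbb{Z}$.
   Context: $X$ denotes the space of continuous functions on $\mathbb{R}$ of at most polynomial growth; each $f\in X$ is a tempered (Schwartz) distribution. The spectrum of $f\in X$ is the minimal closed set $S$ such that $\int_{\mathbb{R}} f(t)\varphi(t)\,dt=0$ for every test function $\varphi$ whose Fourier transform $\hat\varphi$ vanishes in a neighbourhood of $S$ (Fourier transform $\hat\varphi(t)=\int e^{-2\pi i t x}\varphi(x)\,dx$). For a closed set $S$, $X_S$ is the subspace of $X$ of functions with spectrum in $S$. A set $\Lambda$ is uniformly discrete if $\inf\{|\lambda-\lambda'|:\lambda\neq\lambda'\in\Lambda\}>0$; it has uniform density $D(\Lambda)$ if $\mathrm{Card}(\Lambda\cap(x,x+r))=rD(\Lambda)+o(r)$ uniformly in $x$ as $r\to\infty$. $\Lambda$ is a uniqueness set for $X_S$ if $f\in X_S$, $f|_\Lambda=0$ imply $f=0$. *)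

theory Defs
  imports "HOL-Analysis.Analysis"
begin

definition poly_growth_space :: "(real \<Rightarrow> complex) set" where
  "poly_growth_space = {f. continuous_on UNIV f \<and>
     (\<exists>C (N::nat). \<forall>x. norm (f x) \<le> C * (1 + \<bar>x\<bar>) ^ N)}"

definition schwartz :: "(real \<Rightarrow> complex) \<Rightarrow> bool" where
  "schwartz phi \<longleftrightarrow> (\<exists>D :: nat \<Rightarrow> real \<Rightarrow> complex. D 0 = phi \<and>
     (\<forall>n x. (D n has_vector_derivative D (Suc n) x) (at x)) \<and>
     (\<forall>n (k::nat). \<exists>C. \<forall>x. \<bar>x\<bar> ^ k * norm (D n x) \<le> C))"

definition fourier :: "(real \<Rightarrow> complex) \<Rightarrow> real \<Rightarrow> complex" where
  "fourier phi t = integral UNIV (\<lambda>x. exp (- 2 * pi * \<i> * complex_of_real (t * x)) * phi x)"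

definition annihilates :: "real set \<Rightarrow> (real \<Rightarrow> complex) \<Rightarrow> bool" where
  "annihilates S f \<longleftrightarrow> (\<forall>phi. schwartz phi \<and>
      (\<exists>U. open U \<and> S \<subseteq> U \<and> (\<forall>t\<in>U. fourier phi t = 0))
      \<longrightarrow> integral UNIV (\<lambda>x. f x * phi x) = 0)"

definition spectrum_of :: "(real \<Rightarrow> complex) \<Rightarrow> real set" where
  "spectrum_of f = \<Inter> {S. closed S \<and> annihilates S f}"

definition X_S :: "real set \<Rightarrow> (real \<Rightarrow> complex) set" where
  "X_S S = {f \<in> poly_growth_space. spectrum_of f \<subseteq> S}"

definition uniformly_discrete :: "real set \<Rightarrow> bool" where
  "uniformly_discrete L \<longleftrightarrow> (\<exists>d>0. \<forall>a\<in>L. \<forall>b\<in>L. a \<noteq> b \<longrightarrow> d \<le> \<bar>a - b\<bar>)"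

definition has_uniform_density :: "real set \<Rightarrow> real \<Rightarrow> bool" where
  "has_uniform_density L D \<longleftrightarrow> (\<forall>e>0. \<exists>R. \<forall>r\<ge>R. \<forall>x.
      finite (L \<inter> {x<..<x+r}) \<and> \<bar>real (card (L \<inter> {x<..<x+r})) - r * D\<bar> \<le> e * r)"

definition uniqueness_set :: "real set \<Rightarrow> (real \<Rightarrow> complex) set \<Rightarrow> bool" where
  "uniqueness_set L Y \<longleftrightarrow> (\<forall>f\<in>Y. (\<forall>l\<in>L. f l = 0) \<longrightarrow> f = (\<lambda>_. 0))"

end

theory Submission
  imports Defs "HOL-Complex_Analysis.Complex_Analysis" "HOL-Probability.Characteristic_Functions"
    "HOL-Probability.Sinc_Integral" "HOL-Real_Asymp.Real_Asymp"
begin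

text \<open>
  If the spectrum of \<open>f\<close> lies in \<open>[0,1-\<delta>] + \<int>\<close>, then on every translate \<open>s + \<int>\<close> the values
  of \<open>f\<close> are interpolated by a function of spectrum in a slightly enlarged interval of length less
  than \<open>1\<close>: the discrete convolution of \<open>f\<close> with the samples \<open>K n\<close> reproduces \<open>f\<close> as soon as the
  \<open>1\<close>-periodic multiplier \<open>\<Sum>n. K n e\<^bsup>2\<pi>int\<^esup>\<close> equals \<open>1\<close> near the spectrum, and
  \<open>F z = \<Sum>n. f (n + s) K (z - n)\<close> is then entire of exponential type less than \<open>\<pi>\<close> (after centring)
  with polynomial growth on the line. Such an \<open>F\<close> vanishes identically if it vanishes at all integers
  of infinitely many double blocks \<open>a \<le> \<bar>n\<bar> < a\<^sup>2\<close>; no zeros are needed elsewhere. So the integers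
  can be cut into blocks \<open>2\<^bsup>2^k\<^esup> \<le> \<bar>n\<bar> < 2\<^bsup>2^(k+1)\<^esup>\<close>, each shifted by its own number, in such a way
  that every rational shift in \<open>[0,1)\<close> occurs in infinitely many blocks. Then \<open>f\<close> vanishes on
  all of \<open>\<rat>\<close>, hence everywhere.
\<close>

section \<open>Entire functions vanishing on long blocks of integers\<close>

lemma holomorphic_quotient_simple_zeros:
  fixes f g :: "complex \<Rightarrow> complex"
  assumes "open S" "finite K" "K \<subseteq> S" and f: "f holomorphic_on S" and g: "g holomorphic_on S"
    and g_nz: "\<And>z. z \<in> S - K \<Longrightarrow> g z \<noteq> 0"
    and simple: "\<And>z. z \<in> K \<Longrightarrow> f z = 0 \<and> g z = 0 \<and> deriv g z \<noteq> 0"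
  obtains h where "h holomorphic_on S" "\<And>z. z \<in> S \<Longrightarrow> f z = h z * g z"
proof -
  define h where "h z = (if z \<in> K then deriv f z / deriv g z else f z / g z)" for z
  have "h holomorphic_on S"
  proof (rule no_isolated_singularity'[OF _ _ \<open>open S\<close> \<open>finite K\<close>])
    fix z assume "z \<in> K"
    with \<open>K \<subseteq> S\<close> have "z \<in> S" by blast
    have "((\<lambda>w. f w / g w) \<longlongrightarrow> deriv f z / deriv g z) (at z)"
      using simple[OF \<open>z \<in> K\<close>] holomorphic_derivI[OF f \<open>open S\<close> \<open>z \<in> S\<close>]
        holomorphic_derivI[OF g \<open>open S\<close> \<open>z \<in> S\<close>]
      by (intro lhopital_complex_simple) auto
    moreover have "\<forall>\<^sub>F w in at z. f w / g w = h w"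
    proof -
      have "\<forall>\<^sub>F w in at z. w \<in> - (K - {z}) - {z}"
        using \<open>finite K\<close> by (intro eventually_at_in_open open_Compl finite_imp_closed) auto
      thus ?thesis by eventually_elim (auto simp: h_def)
    qed
    ultimately have "(h \<longlongrightarrow> deriv f z / deriv g z) (at z)" by (rule Lim_transform_eventually)
    thus "(h \<longlongrightarrow> h z) (at z within S)"
      using \<open>z \<in> K\<close> by (simp add: h_def Lim_at_imp_Lim_at_within)
  next
    have "(\<lambda>z. f z / g z) holomorphic_on S - K"
      using f g g_nz by (auto intro!: holomorphic_on_divide elim: holomorphic_on_subset)
    thus "h holomorphic_on S - K" by (rule holomorphic_transform) (simp add: h_def)
  qed
  moreover have "f z = h z * g z" if "z \<in> S" for z
    using simple[of z] g_nz[of z] that by (cases "z \<in> K") (auto simp: h_def)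
  ultimately show thesis using that by blast
qed

lemma sin_pi_eq_0_iff_Ints: "sin (of_real pi * z) = 0 \<longleftrightarrow> z \<in> \<int>" for z :: complex
  by (auto simp: sin_eq_0 Ints_def)

lemma holomorphic_quotient_sin_pi:
  assumes J: "J holomorphic_on ball 0 r" and zero: "\<And>n::int. \<bar>real_of_int n\<bar> < r \<Longrightarrow> J (of_int n) = 0"
  obtains H where "H holomorphic_on ball 0 r"
    "\<And>z. z \<in> ball 0 r \<Longrightarrow> J z = H z * sin (of_real pi * z)"
proof (rule holomorphic_quotient_simple_zeros[of "ball 0 r" "\<int> \<inter> ball 0 r" J "\<lambda>z. sin (of_real pi * z)"])
  have "\<int> \<inter> ball 0 r \<subseteq> (of_int ` {- \<lceil>r\<rceil>..\<lceil>r\<rceil>} :: complex set)"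
  proof
    fix z :: complex assume "z \<in> \<int> \<inter> ball 0 r"
    then obtain m :: int where m: "z = of_int m" "\<bar>real_of_int m\<bar> < r" by (auto elim: Ints_cases)
    hence "m \<in> {- \<lceil>r\<rceil>..\<lceil>r\<rceil>}" by (simp, linarith)
    thus "z \<in> of_int ` {- \<lceil>r\<rceil>..\<lceil>r\<rceil>}" using m by blast
  qed
  thus "finite (\<int> \<inter> ball 0 r :: complex set)" by (rule finite_subset) auto
next
  fix z :: complex assume z: "z \<in> \<int> \<inter> ball 0 r"
  have "deriv (\<lambda>z. sin (of_real pi * z)) z = of_real pi * cos (of_real pi * z)"
    by (rule DERIV_imp_deriv) (auto intro!: derivative_eq_intros)
  moreover have "cos (of_real pi * z) \<noteq> 0"
    using z sin_cos_squared_add[of "of_real pi * z"] sin_pi_eq_0_iff_Ints[of z] by fastforce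
  moreover have "J z = 0" using z zero by (auto elim!: Ints_cases)
  ultimately show "J z = 0 \<and> sin (of_real pi * z) = 0 \<and> deriv (\<lambda>z. sin (of_real pi * z)) z \<noteq> 0"
    using z by (simp add: sin_pi_eq_0_iff_Ints)
qed (use J that in \<open>auto intro!: holomorphic_intros simp: sin_pi_eq_0_iff_Ints\<close>)

lemma cos_2pi_nonpos_near_half_integers:
  assumes "\<bar>\<bar>x\<bar> - (real b + 1/2)\<bar> \<le> 1/4"
  shows "cos (2 * pi * x) \<le> 0"
proof -
  define d where "d = 2 * pi * (\<bar>x\<bar> - (real b + 1/2))"
  have "\<bar>d\<bar> = 2 * pi * \<bar>\<bar>x\<bar> - (real b + 1/2)\<bar>" by (simp add: d_def abs_mult)
  also have "\<dots> \<le> 2 * pi * (1/4)" using assms by (intro mult_left_mono) auto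
  finally have d: "\<bar>d\<bar> \<le> pi / 2" by simp
  have "cos (2 * pi * x) = cos (2 * pi * \<bar>x\<bar>)" by (simp add: abs_if)
  also have "2 * pi * \<bar>x\<bar> = d + pi + 2 * pi * real b" by (simp add: d_def algebra_simps)
  also have "cos \<dots> = - cos d"
    using cos_2npi[of b] sin_2npi[of b] by (simp add: cos_add mult_ac)
  also have "\<dots> \<le> 0" using d by (simp add: abs_le_iff cos_ge_zero)
  finally show ?thesis .
qed

lemma norm_sin_pi_lower_bound:
  fixes z :: complex
  assumes "norm z = real b + 1/2" "b \<ge> 1"
  shows "exp (pi * \<bar>Im z\<bar>) / 3 \<le> norm (sin (of_real pi * z))"
proof -
  define E where "E = exp (2 * pi * \<bar>Im z\<bar>)"
  have "E / 9 \<le> (E - 2 * cos (2 * pi * Re z)) / 4"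
  proof (cases "\<bar>Im z\<bar> \<ge> 1/2")
    case True
    hence "pi \<le> 2 * pi * \<bar>Im z\<bar>" by (simp add: field_simps)
    hence "E \<ge> 4"
      using exp_ge_add_one_self[of "2 * pi * \<bar>Im z\<bar>"] pi_gt3 unfolding E_def by linarith
    thus ?thesis using cos_le_one[of "2 * pi * Re z"] by argo
  next
    case False
    define R where "R = real b + 1/2"
    have R: "R \<ge> 3/2" "\<bar>Re z\<bar> \<le> R"
      using assms abs_Re_le_cmod[of z] by (auto simp: R_def)
    have "(R - \<bar>Re z\<bar>) * 1 \<le> (R - \<bar>Re z\<bar>) * (R + \<bar>Re z\<bar>)"
      using R by (intro mult_left_mono) auto
    also have "\<dots> = \<bar>Im z\<bar>\<^sup>2"
      using cmod_power2[of z] assms(1) by (simp add: R_def algebra_simps power2_eq_square)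
    also have "\<dots> \<le> (1/2)\<^sup>2" using False by (intro power_mono) auto
    finally have "\<bar>\<bar>Re z\<bar> - (real b + 1/2)\<bar> \<le> 1/4" using R by (simp add: R_def power2_eq_square)
    hence "cos (2 * pi * Re z) \<le> 0" by (rule cos_2pi_nonpos_near_half_integers)
    thus ?thesis using exp_gt_zero[of "2 * pi * \<bar>Im z\<bar>"] unfolding E_def by argo
  qed
  also have "\<dots> \<le> (norm (sin (of_real pi * z)))\<^sup>2"
  proof -
    have "E \<le> exp (2 * (pi * Im z)) + inverse (exp (2 * (pi * Im z)))"
      unfolding E_def by (cases "Im z \<ge> 0") (simp_all add: exp_minus[symmetric] mult.assoc)
    thus ?thesis unfolding norm_sin_squared by (simp add: mult.assoc)
  qed
  finally have "(exp (pi * \<bar>Im z\<bar>) / 3)\<^sup>2 \<le> (norm (sin (of_real pi * z)))\<^sup>2"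
    by (simp add: E_def power2_eq_square mult.assoc flip: exp_add)
  thus ?thesis by (rule power2_le_imp_le) simp
qed

text \<open>
  On the circle, \<open>exp (c R / 2 - c z\<^sup>2 / (2 R))\<close> has modulus \<open>exp (c (Im z)\<^sup>2 / R) \<le> exp (c \<bar>Im z\<bar>)\<close>, so
  multiplying by it keeps the boundary values below \<open>M\<close>; near the centre it is of size \<open>exp (c R / 2)\<close>.
\<close>

lemma norm_le_of_exp_decay_on_circle:
  fixes H :: "complex \<Rightarrow> complex"
  assumes cont: "continuous_on (cball 0 R) H" and hol: "H holomorphic_on ball 0 R" and "R > 0" "c \<ge> 0"
    and bound: "\<And>z. norm z = R \<Longrightarrow> norm (H z) \<le> M * exp (- c * \<bar>Im z\<bar>)"
    and w: "norm w \<le> R"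
  shows "norm (H w) \<le> M * exp (- (c / 2) * (R - (norm w)\<^sup>2 / R))"
proof -
  define W where "W z = exp (of_real (c * R / 2) - of_real (c / (2 * R)) * z\<^sup>2)" for z :: complex
  have norm_W: "norm (W z) = exp (c / 2 * (R - Re (z\<^sup>2) / R))" for z
    using \<open>R > 0\<close> by (simp add: W_def norm_exp_eq_Re field_simps)
  have "norm (H w * W w) \<le> M"
  proof (rule maximum_modulus_frontier[of "\<lambda>z. H z * W z" "cball 0 R"])
    show "(\<lambda>z. H z * W z) holomorphic_on interior (cball 0 R)"
      unfolding W_def by (intro holomorphic_intros) (use hol in simp)
    show "continuous_on (closure (cball 0 R)) (\<lambda>z. H z * W z)"
      unfolding W_def by (intro continuous_intros) (use cont in simp)
  next
    fix z :: complex assume "z \<in> frontier (cball 0 R)"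
    hence z: "norm z = R" using \<open>R > 0\<close> by (simp add: frontier_cball)
    have "R - Re (z\<^sup>2) / R = 2 * (Im z)\<^sup>2 / R"
      using cmod_power2[of z] z \<open>R > 0\<close> by (simp add: Re_power2 field_simps power2_eq_square)
    also have "\<dots> \<le> 2 * (R * \<bar>Im z\<bar>) / R"
      using abs_Im_le_cmod[of z] z \<open>R > 0\<close> mult_right_mono[of "\<bar>Im z\<bar>" R "\<bar>Im z\<bar>"]
      by (intro divide_right_mono) (auto simp: power2_eq_square)
    finally have "norm (W z) \<le> exp (c * \<bar>Im z\<bar>)"
      using \<open>R > 0\<close> \<open>c \<ge> 0\<close> mult_left_mono[of "R - Re (z\<^sup>2) / R" "2 * \<bar>Im z\<bar>" "c / 2"]
      by (simp add: norm_W)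
    hence "norm (H z * W z) \<le> (M * exp (- c * \<bar>Im z\<bar>)) * exp (c * \<bar>Im z\<bar>)"
      unfolding norm_mult using bound[OF z] by (intro mult_mono) (auto intro: order_trans[OF norm_ge_zero])
    thus "norm (H z * W z) \<le> M" by (simp add: mult.assoc flip: exp_add)
  qed (use w in auto)
  moreover have "exp (c / 2 * (R - (norm w)\<^sup>2 / R)) \<le> norm (W w)"
    using complex_Re_le_cmod[of "w\<^sup>2"] \<open>R > 0\<close> \<open>c \<ge> 0\<close> unfolding norm_W
    by (auto simp: norm_power intro!: mult_left_mono divide_right_mono)
  ultimately have "norm (H w) * exp (c / 2 * (R - (norm w)\<^sup>2 / R)) \<le> M"
    by (metis mult_left_mono norm_ge_zero norm_mult order_trans)
  hence "norm (H w) * exp (c / 2 * (R - (norm w)\<^sup>2 / R)) * exp (- (c / 2) * (R - (norm w)\<^sup>2 / R))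
      \<le> M * exp (- (c / 2) * (R - (norm w)\<^sup>2 / R))"
    by (rule mult_right_mono) simp
  thus ?thesis by (simp add: mult.assoc flip: exp_add)
qed

lemma norm_le_of_norm_times_sin_pi_le:
  fixes z h :: complex
  assumes "norm z = real b + 1/2" "b \<ge> 1"
    and bound: "norm (h * sin (of_real pi * z)) \<le> K * exp ((pi - c) * \<bar>Im z\<bar>)"
  shows "norm h \<le> 3 * K * exp (- c * \<bar>Im z\<bar>)"
proof -
  define E where "E = exp (pi * \<bar>Im z\<bar>)"
  have "norm h * (E / 3) \<le> norm h * norm (sin (of_real pi * z))"
    unfolding E_def by (intro mult_left_mono norm_sin_pi_lower_bound[OF assms(1,2)]) simp
  also have "\<dots> \<le> K * exp (- c * \<bar>Im z\<bar>) * E"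
    using bound by (simp add: E_def norm_mult mult.assoc left_diff_distrib flip: exp_add)
  finally have "norm h * E \<le> (3 * K * exp (- c * \<bar>Im z\<bar>)) * E" by simp
  thus ?thesis by (rule mult_right_le_imp_le) (simp add: E_def)
qed

definition central_product :: "nat \<Rightarrow> complex \<Rightarrow> complex" where
  "central_product a z = (\<Prod>n\<in>{- (int a - 1)..int a - 1}. z - of_int n)"

lemma holomorphic_central_product: "central_product a holomorphic_on S"
  unfolding central_product_def[abs_def] by (intro holomorphic_intros)

lemma central_product_of_int: "\<bar>n\<bar> < int a \<Longrightarrow> central_product a (of_int n) = 0"
  unfolding central_product_def by (intro prod_zero bexI[of _ n]) auto

lemma norm_central_product_le:
  assumes "norm z \<le> r" "real a \<le> r" "1 \<le> r"
  shows "norm (central_product a z) \<le> (2 * r) ^ (2 * a)"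
  unfolding central_product_def prod_norm[symmetric]
proof (rule prod_le_power)
  fix n assume "n \<in> {- (int a - 1)..int a - 1}"
  hence "norm (of_int n :: complex) \<le> real a" unfolding norm_of_int by auto
  thus "0 \<le> norm (z - of_int n) \<and> norm (z - of_int n) \<le> 2 * r"
    using norm_triangle_ineq4[of z "of_int n"] assms by auto
qed (use assms in auto)

lemma norm_central_product_ge_1:
  assumes "\<bar>Im z\<bar> \<ge> 1"
  shows "1 \<le> norm (central_product a z)"
  unfolding central_product_def prod_norm[symmetric]
proof (rule prod_ge_1)
  show "1 \<le> norm (z - of_int n)" for n
    using abs_Im_le_cmod[of "z - of_int n"] assms by simp
qed

lemma norm_mult_central_product_le:
  assumes g: "norm g \<le> C * (1 + norm z) ^ N * E" "0 \<le> C" "0 \<le> E" and r: "norm z \<le> r" "real a \<le> r" "1 \<le> r"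
  shows "norm (g * central_product a z) \<le> C * (2 * r) ^ (N + 2 * a) * E"
proof -
  have "(1 + norm z) ^ N \<le> (2 * r) ^ N"
    using r by (intro power_mono) auto
  hence "C * (1 + norm z) ^ N * E \<le> C * (2 * r) ^ N * E"
    using g by (intro mult_right_mono mult_left_mono)
  hence "norm g * norm (central_product a z) \<le> (C * (2 * r) ^ N * E) * (2 * r) ^ (2 * a)"
    using g r by (intro mult_mono norm_central_product_le) auto
  thus ?thesis by (simp add: norm_mult power_add mult_ac)
qed

lemma quotient_of_zeros_on_block:
  fixes G :: "complex \<Rightarrow> complex" and C c :: real and a N :: nat
  defines "M \<equiv> C * (2 * (real a)\<^sup>2) ^ (N + 2 * a)"
  assumes hol: "G holomorphic_on UNIV"
    and bound: "\<And>z. norm (G z) \<le> C * (1 + norm z) ^ N * exp ((pi - c) * \<bar>Im z\<bar>)"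
    and "a \<ge> 2" and zeros: "\<And>n::int. int a \<le> \<bar>n\<bar> \<Longrightarrow> \<bar>n\<bar> < int (a\<^sup>2) \<Longrightarrow> G (of_int n) = 0"
  obtains H where "H holomorphic_on ball 0 ((real a)\<^sup>2)"
    "\<And>z. z \<in> ball 0 ((real a)\<^sup>2) \<Longrightarrow> G z * central_product a z = H z * sin (of_real pi * z)"
    "\<And>z. norm z = (real a)\<^sup>2 - 1/2 \<Longrightarrow> norm (H z) \<le> 3 * M * exp (- c * \<bar>Im z\<bar>)"
proof -
  define J where "J z = G z * central_product a z" for z
  have "J holomorphic_on ball 0 ((real a)\<^sup>2)"
    unfolding J_def[abs_def]
    by (intro holomorphic_intros holomorphic_central_product holomorphic_on_subset[OF hol]) auto
  moreover have "J (of_int n) = 0" if "\<bar>real_of_int n\<bar> < (real a)\<^sup>2" for n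
  proof -
    have "\<bar>n\<bar> < int (a\<^sup>2)" using that by (metis of_int_abs of_int_less_iff of_int_of_nat_eq of_nat_power)
    thus ?thesis using zeros[of n] central_product_of_int[of n a] by (force simp: J_def)
  qed
  ultimately obtain H where H: "H holomorphic_on ball 0 ((real a)\<^sup>2)"
    and J_eq: "\<And>z. z \<in> ball 0 ((real a)\<^sup>2) \<Longrightarrow> J z = H z * sin (of_real pi * z)"
    using holomorphic_quotient_sin_pi[of J "(real a)\<^sup>2"] by blast
  have "norm (H z) \<le> 3 * M * exp (- c * \<bar>Im z\<bar>)" if z: "norm z = (real a)\<^sup>2 - 1/2" for z
  proof (rule norm_le_of_norm_times_sin_pi_le)
    have a_sq: "real a \<le> (real a)\<^sup>2" "2 \<le> a\<^sup>2"
      using \<open>a \<ge> 2\<close> mult_mono[of 1 a 2 a] by (auto simp: power2_eq_square)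
    thus "norm z = real (a\<^sup>2 - 1) + 1/2" "a\<^sup>2 - 1 \<ge> 1"
      using z by (simp_all add: of_nat_diff)
    have "0 \<le> C" using order_trans[OF norm_ge_zero bound[of 0]] by simp
    hence "norm (J z) \<le> M * exp ((pi - c) * \<bar>Im z\<bar>)"
      unfolding J_def M_def using z a_sq \<open>a \<ge> 2\<close> by (intro norm_mult_central_product_le[OF bound]) auto
    thus "norm (H z * sin (of_real pi * z)) \<le> M * exp ((pi - c) * \<bar>Im z\<bar>)"
      using J_eq[of z] z by simp
  qed
  thus thesis using that H J_eq unfolding J_def by blast
qed

lemma norm_entire_le_of_zeros_on_block:
  fixes G :: "complex \<Rightarrow> complex"
  assumes "G holomorphic_on UNIV" and "c \<ge> 0"
    and bound: "\<And>z. norm (G z) \<le> C * (1 + norm z) ^ N * exp ((pi - c) * \<bar>Im z\<bar>)"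
    and "a \<ge> 2" and "\<And>n::int. int a \<le> \<bar>n\<bar> \<Longrightarrow> \<bar>n\<bar> < int (a\<^sup>2) \<Longrightarrow> G (of_int n) = 0"
    and w: "\<bar>Im w\<bar> \<ge> 1" "norm w \<le> real a"
  shows "norm (G w) \<le> 3 * C * norm (sin (of_real pi * w)) * exp (c * (1 + (norm w)\<^sup>2)) *
    ((2 * (real a)\<^sup>2) ^ (N + 2 * a) * exp (- (c / 2) * (real a)\<^sup>2))"
proof -
  define B where "B = exp (c * (1 + (norm w)\<^sup>2)) * exp (- (c / 2) * (real a)\<^sup>2)"
  define R where "R = (real a)\<^sup>2 - 1/2"
  define M where "M = C * (2 * (real a)\<^sup>2) ^ (N + 2 * a)"
  have "2 * real a \<le> (real a)\<^sup>2" using \<open>a \<ge> 2\<close> by (simp add: power2_eq_square)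
  hence R: "real a \<le> R" "1 \<le> R" using \<open>a \<ge> 2\<close> by (auto simp: R_def)
  have "0 \<le> M" using order_trans[OF norm_ge_zero bound[of 0]] by (simp add: M_def)
  obtain H where H: "H holomorphic_on ball 0 ((real a)\<^sup>2)"
    and GH: "\<And>z. z \<in> ball 0 ((real a)\<^sup>2) \<Longrightarrow> G z * central_product a z = H z * sin (of_real pi * z)"
    and H_circle: "\<And>z. norm z = R \<Longrightarrow> norm (H z) \<le> 3 * M * exp (- c * \<bar>Im z\<bar>)"
    using quotient_of_zeros_on_block[of G C N c a] assms unfolding R_def M_def by blast
  have "H holomorphic_on cball 0 R"
    by (rule holomorphic_on_subset[OF H]) (auto simp: R_def)
  hence "norm (H w) \<le> 3 * M * exp (- (c / 2) * (R - (norm w)\<^sup>2 / R))"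
    using H_circle R w \<open>c \<ge> 0\<close> ball_subset_cball[of 0 R]
    by (intro norm_le_of_exp_decay_on_circle)
       (auto intro: holomorphic_on_imp_continuous_on holomorphic_on_subset)
  also have "\<dots> \<le> 3 * M * B"
  proof -
    have "(norm w)\<^sup>2 / R \<le> (norm w)\<^sup>2"
      using R mult_right_mono[of 1 R "(norm w)\<^sup>2"] by (simp add: field_simps)
    hence "- (c / 2) * (R - (norm w)\<^sup>2 / R) \<le> - (c / 2) * ((real a)\<^sup>2 - 1/2 - (norm w)\<^sup>2)"
      using \<open>c \<ge> 0\<close> unfolding R_def by (intro mult_left_mono_neg) auto
    also have "\<dots> \<le> c * (1 + (norm w)\<^sup>2) + - (c / 2) * (real a)\<^sup>2"
      using \<open>c \<ge> 0\<close> mult_nonneg_nonneg[OF \<open>c \<ge> 0\<close> zero_le_power2[of "norm w"]] by argo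
    finally show ?thesis unfolding B_def exp_add[symmetric] using \<open>0 \<le> M\<close> by (intro mult_left_mono) auto
  qed
  finally have H_le: "norm (H w) \<le> 3 * M * B" .
  have "norm (G w) \<le> norm (G w * central_product a w)"
    using norm_central_product_ge_1[OF w(1), of a] by (simp add: norm_mult mult_le_cancel_left1)
  also have "\<dots> = norm (H w) * norm (sin (of_real pi * w))"
    using GH[of w] w R by (simp add: R_def norm_mult)
  also have "\<dots> \<le> 3 * M * B * norm (sin (of_real pi * w))" by (intro mult_right_mono H_le) simp
  finally show ?thesis by (simp only: B_def M_def mult_ac)
qed

lemma entire_eq_0_of_zeros_on_long_blocks:
  fixes G :: "complex \<Rightarrow> complex"
  assumes hol: "G holomorphic_on UNIV" and "c > 0"
    and bound: "\<And>z. norm (G z) \<le> C * (1 + norm z) ^ N * exp ((pi - c) * \<bar>Im z\<bar>)"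
    and zeros: "\<exists>\<^sub>\<infinity>a::nat. \<forall>n::int. int a \<le> \<bar>n\<bar> \<and> \<bar>n\<bar> < int (a\<^sup>2) \<longrightarrow> G (of_int n) = 0"
  shows "G z = 0"
proof -
  have zero_off_strip: "G w = 0" if w: "\<bar>Im w\<bar> \<ge> 1" for w
  proof -
    define B where "B a = 3 * C * norm (sin (of_real pi * w)) * exp (c * (1 + (norm w)\<^sup>2)) *
      ((2 * (real a)\<^sup>2) ^ (N + 2 * a) * exp (- (c / 2) * (real a)\<^sup>2))" for a
    have "(\<lambda>a::nat. (2 * (real a)\<^sup>2) ^ (N + 2 * a) * exp (- (c / 2) * (real a)\<^sup>2)) \<longlonglongrightarrow> 0"
      using \<open>c > 0\<close> by real_asymp
    hence "B \<longlonglongrightarrow> 0" unfolding B_def by (rule tendsto_mult_right_zero)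
    moreover have "\<exists>\<^sub>F a in sequentially. norm (G w) \<le> B a"
    proof -
      have "\<forall>\<^sub>F a in sequentially. a \<ge> 2 \<and> real a \<ge> norm w"
        by (intro eventually_conj eventually_ge_at_top) real_asymp
      hence "\<exists>\<^sub>F a in sequentially. (\<forall>n::int. int a \<le> \<bar>n\<bar> \<and> \<bar>n\<bar> < int (a\<^sup>2) \<longrightarrow> G (of_int n) = 0)
          \<and> a \<ge> 2 \<and> real a \<ge> norm w"
        using zeros by (simp add: cofinite_eq_sequentially frequently_eventually_frequently)
      thus ?thesis
        unfolding B_def
        by (rule frequently_elim1)
           (use \<open>c > 0\<close> w in \<open>blast intro: less_imp_le norm_entire_le_of_zeros_on_block[OF hol _ bound]\<close>)
    qed
    ultimately have "norm (G w) \<le> 0"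
      using order_tendstoD(2)[of B 0 sequentially "norm (G w)"]
      by (fastforce simp: frequently_def not_le elim: eventually_mono)
    thus ?thesis by simp
  qed
  show ?thesis
  proof (rule analytic_continuation[OF hol, of "ball (2 * \<i>) 1" "2 * \<i>"])
    show "2 * \<i> islimpt ball (2 * \<i>) 1" by (intro open_imp_islimpt) auto
    fix w :: complex assume "w \<in> ball (2 * \<i>) 1"
    hence "\<bar>Im (2 * \<i> - w)\<bar> < 1" using abs_Im_le_cmod[of "2 * \<i> - w"] by (simp add: dist_norm)
    thus "G w = 0" by (intro zero_off_strip) auto
  qed auto
qed

section \<open>Smooth functions with constrained derivatives\<close>

definition smooth_in :: "(real \<Rightarrow> 'a :: real_normed_vector) set \<Rightarrow> (real \<Rightarrow> 'a) set" where
  "smooth_in V = {f. \<exists>D. D 0 = f \<and> (\<forall>n x. (D n has_vector_derivative D (Suc n) x) (at x)) \<and> (\<forall>n. D n \<in> V)}"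

lemma smooth_in_coinduct:
  assumes "f \<in> A" "A \<subseteq> V" "\<And>g. g \<in> A \<Longrightarrow> \<exists>g'\<in>A. \<forall>x. (g has_vector_derivative g' x) (at x)"
  shows "f \<in> smooth_in V"
proof -
  have "\<exists>D. \<forall>n. (D n \<in> A \<and> (n = 0 \<longrightarrow> D n = f)) \<and> (\<forall>x. (D n has_vector_derivative D (Suc n) x) (at x))"
    by (intro dependent_nat_choice) (use assms in blast)+
  then obtain D where "\<And>n. D n \<in> A" "D 0 = f" "\<And>n x. (D n has_vector_derivative D (Suc n) x) (at x)"
    by blast
  thus ?thesis using \<open>A \<subseteq> V\<close> unfolding smooth_in_def by (intro CollectI exI[of _ D]) auto
qed

lemma smooth_inD: "f \<in> smooth_in V \<Longrightarrow> f \<in> V"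
  unfolding smooth_in_def by blast

lemma smooth_in_mono: "V \<subseteq> W \<Longrightarrow> smooth_in V \<subseteq> smooth_in W"
  unfolding smooth_in_def by blast

lemma smooth_in_derivative:
  assumes "f \<in> smooth_in V"
  obtains f' where "f' \<in> smooth_in V" "\<And>x. (f has_vector_derivative f' x) (at x)"
proof -
  obtain D where D: "D 0 = f" "\<forall>n x. (D n has_vector_derivative D (Suc n) x) (at x)" "\<forall>n. D n \<in> V"
    using assms unfolding smooth_in_def by blast
  have "D 1 \<in> smooth_in V"
    unfolding smooth_in_def by (intro CollectI exI[of _ "\<lambda>n. D (Suc n)"]) (use D in auto)
  thus thesis using that D by (metis One_nat_def)
qed

lemma smooth_in_continuous_on: "f \<in> smooth_in V \<Longrightarrow> continuous_on S f"
  by (metis smooth_in_derivative has_vector_derivative_continuous continuous_at_imp_continuous_on)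

lemma smooth_in_affine:
  assumes f: "f \<in> smooth_in V" and W: "\<And>g c. g \<in> V \<Longrightarrow> (\<lambda>x. c *\<^sub>R g (a * x + b)) \<in> W"
  shows "(\<lambda>x. f (a * x + b)) \<in> smooth_in W"
proof (rule smooth_in_coinduct)
  let ?A = "{(\<lambda>x. c *\<^sub>R g (a * x + b)) | g c. g \<in> smooth_in V}"
  show "(\<lambda>x. f (a * x + b)) \<in> ?A" using f by (auto intro!: exI[of _ f] exI[of _ 1])
  show "?A \<subseteq> W" using W by (auto dest: smooth_inD)
  fix h assume "h \<in> ?A"
  then obtain g c where h: "h = (\<lambda>x. c *\<^sub>R g (a * x + b))" and g: "g \<in> smooth_in V" by blast
  obtain g' where g': "g' \<in> smooth_in V" "\<And>x. (g has_vector_derivative g' x) (at x)"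
    using smooth_in_derivative[OF g] by blast
  have "(h has_vector_derivative (c * a) *\<^sub>R g' (a * x + b)) (at x)" for x
  proof -
    have "((\<lambda>x. a * x + b) has_vector_derivative a) (at x)"
      by (auto intro!: derivative_eq_intros simp: has_real_derivative_iff_has_vector_derivative[symmetric])
    from vector_diff_chain_at[OF this g'(2)]
    have "((\<lambda>x. g (a * x + b)) has_vector_derivative a *\<^sub>R g' (a * x + b)) (at x)"
      by (simp add: o_def)
    thus ?thesis
      unfolding h by (auto intro!: derivative_eq_intros)
  qed
  thus "\<exists>h'\<in>?A. \<forall>x. (h has_vector_derivative h' x) (at x)"
    using g'(1) by (intro bexI[of _ "\<lambda>x. (c * a) *\<^sub>R g' (a * x + b)"]) auto
qed

inductive_set product_sums :: "(real \<Rightarrow> 'a :: semiring) set \<Rightarrow> (real \<Rightarrow> 'a) set \<Rightarrow> (real \<Rightarrow> 'a) set"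
  for V G where
  prod: "f \<in> V \<Longrightarrow> g \<in> G \<Longrightarrow> (\<lambda>x. f x * g x) \<in> product_sums V G"
| add: "p \<in> product_sums V G \<Longrightarrow> q \<in> product_sums V G \<Longrightarrow> (\<lambda>x. p x + q x) \<in> product_sums V G"

lemma has_vector_derivative_mult_supported:
  fixes f g :: "real \<Rightarrow> 'a :: real_normed_algebra"
  assumes "closed X" and vanish: "\<And>y. y \<notin> X \<Longrightarrow> f y = 0 \<and> f' y = 0"
    and f: "(f has_vector_derivative f' x) (at x)" and g: "x \<in> X \<Longrightarrow> (g has_vector_derivative g' x) (at x)"
  shows "((\<lambda>x. f x * g x) has_vector_derivative f x * g' x + f' x * g x) (at x)"
proof (cases "x \<in> X")
  case True
  thus ?thesis by (intro has_vector_derivative_mult f g)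
next
  case False
  have "((\<lambda>x. f x * g x) has_vector_derivative 0) (at x)"
    by (rule has_vector_derivative_transform_within_open[of "\<lambda>_. 0" _ _ "- X"])
       (use False \<open>closed X\<close> vanish in auto)
  thus ?thesis using vanish False by simp
qed

lemma smooth_in_mult:
  fixes f g :: "real \<Rightarrow> 'a :: real_normed_algebra"
  assumes f: "f \<in> smooth_in V" and g: "g \<in> G"
    and G: "\<And>g. g \<in> G \<Longrightarrow> \<exists>g'\<in>G. \<forall>x\<in>X. (g has_vector_derivative g' x) (at x)"
    and X: "closed X" "\<And>f x. f \<in> V \<Longrightarrow> x \<notin> X \<Longrightarrow> f x = 0"
    and W_mult: "\<And>f g. f \<in> V \<Longrightarrow> g \<in> G \<Longrightarrow> (\<lambda>x. f x * g x) \<in> W"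
    and W_add: "\<And>p q. p \<in> W \<Longrightarrow> q \<in> W \<Longrightarrow> (\<lambda>x. p x + q x) \<in> W"
  shows "(\<lambda>x. f x * g x) \<in> smooth_in W"
proof (rule smooth_in_coinduct)
  let ?A = "product_sums (smooth_in V) G"
  show "(\<lambda>x. f x * g x) \<in> ?A" using f g by (rule product_sums.prod)
  have "p \<in> W" if "p \<in> ?A" for p
    using that by induction (auto intro: W_mult W_add dest: smooth_inD)
  thus "?A \<subseteq> W" by blast
  fix p assume "p \<in> ?A"
  thus "\<exists>p'\<in>?A. \<forall>x. (p has_vector_derivative p' x) (at x)"
  proof induction
    case (prod f g)
    obtain f' where f': "f' \<in> smooth_in V" "\<And>x. (f has_vector_derivative f' x) (at x)"
      using smooth_in_derivative[OF prod(1)] by blast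
    obtain g' where g': "g' \<in> G" "\<And>x. x \<in> X \<Longrightarrow> (g has_vector_derivative g' x) (at x)"
      using G[OF prod(2)] by blast
    have "f y = 0 \<and> f' y = 0" if "y \<notin> X" for y
      using that X(2) smooth_inD prod(1) f'(1) by blast
    hence "((\<lambda>x. f x * g x) has_vector_derivative f x * g' x + f' x * g x) (at x)" for x
      by (intro has_vector_derivative_mult_supported[OF X(1) _ f'(2) g'(2)])
    thus ?case
      using prod f'(1) g'(1)
      by (intro bexI[of _ "\<lambda>x. f x * g' x + f' x * g x"] product_sums.intros) auto
  next
    case (add p q)
    then obtain p' q' where "p' \<in> ?A" "q' \<in> ?A"
      "\<And>x. (p has_vector_derivative p' x) (at x)" "\<And>x. (q has_vector_derivative q' x) (at x)" by blast
    thus ?case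
      by (intro bexI[of _ "\<lambda>x. p' x + q' x"]) (auto intro!: derivative_intros product_sums.add)
  qed
qed

subsection \<open>Schwartz functions\<close>

definition rapidly_decreasing :: "(real \<Rightarrow> 'a :: real_normed_vector) \<Rightarrow> bool" where
  "rapidly_decreasing f \<longleftrightarrow> (\<forall>k::nat. \<exists>C. \<forall>x. norm (f x) * (1 + \<bar>x\<bar>) ^ k \<le> C)"

lemma rapidly_decreasingE:
  assumes "rapidly_decreasing f"
  obtains C where "C \<ge> 0" "\<And>x. norm (f x) * (1 + \<bar>x\<bar>) ^ k \<le> C"
proof -
  obtain C where f_le: "norm (f x) * (1 + \<bar>x\<bar>) ^ k \<le> C" for x
    using assms unfolding rapidly_decreasing_def by metis
  moreover have "0 \<le> C" by (rule order_trans[OF _ f_le[of 0]]) simp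
  ultimately show thesis using that by blast
qed

lemma rapidly_decreasing_iff_moments:
  "rapidly_decreasing f \<longleftrightarrow> (\<forall>k::nat. \<exists>C. \<forall>x. \<bar>x\<bar> ^ k * norm (f x) \<le> C)"
proof (intro iffI allI)
  fix k :: nat assume "rapidly_decreasing f"
  then obtain C where f_le: "norm (f x) * (1 + \<bar>x\<bar>) ^ k \<le> C" for x
    using rapidly_decreasingE[where k = k] by blast
  have "\<bar>x\<bar> ^ k * norm (f x) \<le> C" for x
  proof -
    have "norm (f x) * \<bar>x\<bar> ^ k \<le> norm (f x) * (1 + \<bar>x\<bar>) ^ k"
      by (intro mult_left_mono power_mono) auto
    thus ?thesis using f_le[of x] by (simp add: mult.commute)
  qed
  thus "\<exists>C. \<forall>x. \<bar>x\<bar> ^ k * norm (f x) \<le> C" by blast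
next
  assume moments: "\<forall>k::nat. \<exists>C. \<forall>x. \<bar>x\<bar> ^ k * norm (f x) \<le> C"
  show "rapidly_decreasing f"
    unfolding rapidly_decreasing_def
  proof
    fix k :: nat
    obtain B C where f_le: "\<bar>x\<bar> ^ 0 * norm (f x) \<le> B" and moment_le: "\<bar>x\<bar> ^ k * norm (f x) \<le> C" for x
      using moments by metis
    have "norm (f x) * (1 + \<bar>x\<bar>) ^ k \<le> 2 ^ k * (B + C)" for x
    proof -
      have "(1 + \<bar>x\<bar>) ^ k \<le> (2 * max 1 \<bar>x\<bar>) ^ k" by (intro power_mono) auto
      also have "\<dots> \<le> 2 ^ k * (1 + \<bar>x\<bar> ^ k)"
        by (simp add: power_mult_distrib max_def)
      finally have "norm (f x) * (1 + \<bar>x\<bar>) ^ k \<le> norm (f x) * (2 ^ k * (1 + \<bar>x\<bar> ^ k))"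
        by (rule mult_left_mono) simp
      also have "\<dots> = 2 ^ k * (\<bar>x\<bar> ^ 0 * norm (f x) + \<bar>x\<bar> ^ k * norm (f x))"
        by (simp add: algebra_simps)
      also have "\<dots> \<le> 2 ^ k * (B + C)" using f_le moment_le by (intro mult_left_mono add_mono) auto
      finally show ?thesis .
    qed
    thus "\<exists>C. \<forall>x. norm (f x) * (1 + \<bar>x\<bar>) ^ k \<le> C" by blast
  qed
qed

lemma schwartz_iff_smooth_in: "schwartz phi \<longleftrightarrow> phi \<in> smooth_in {f. rapidly_decreasing f}"
  unfolding schwartz_def smooth_in_def mem_Collect_eq rapidly_decreasing_iff_moments ..

lemma one_plus_norm_add_le:
  fixes x y :: "'a :: real_normed_vector"
  shows "1 + norm (x + y) \<le> (1 + norm x) * (1 + norm y)"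
proof -
  have "1 + norm (x + y) \<le> 1 + norm x + norm y" using norm_triangle_ineq[of x y] by simp
  also have "\<dots> \<le> (1 + norm x) * (1 + norm y)" by (simp add: algebra_simps)
  finally show ?thesis .
qed

lemma rapidly_decreasing_shift_bound:
  assumes "rapidly_decreasing phi"
  obtains C where "C \<ge> 0" "\<And>x r. norm (phi (x + r)) * (1 + \<bar>x\<bar>) ^ k \<le> C * (1 + \<bar>r\<bar>) ^ k"
proof -
  obtain C where "C \<ge> 0" and phi_le: "norm (phi x) * (1 + \<bar>x\<bar>) ^ k \<le> C" for x
    using rapidly_decreasingE[OF assms, where k = k] by blast
  have "norm (phi (x + r)) * (1 + \<bar>x\<bar>) ^ k \<le> C * (1 + \<bar>r\<bar>) ^ k" for x r
  proof -
    have "norm (phi (x + r)) * (1 + \<bar>x\<bar>) ^ k \<le> norm (phi (x + r)) * ((1 + \<bar>x + r\<bar>) * (1 + \<bar>r\<bar>)) ^ k"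
      using one_plus_norm_add_le[of "x + r" "- r"] by (intro mult_left_mono power_mono) auto
    also have "\<dots> = (norm (phi (x + r)) * (1 + \<bar>x + r\<bar>) ^ k) * (1 + \<bar>r\<bar>) ^ k"
      by (simp add: power_mult_distrib)
    also have "\<dots> \<le> C * (1 + \<bar>r\<bar>) ^ k" by (rule mult_right_mono[OF phi_le]) simp
    finally show ?thesis .
  qed
  thus thesis using that \<open>C \<ge> 0\<close> by blast
qed

lemma rapidly_decreasing_affine:
  assumes "rapidly_decreasing f" "a \<noteq> 0"
  shows "rapidly_decreasing (\<lambda>x. c *\<^sub>R f (a * x + b))"
  unfolding rapidly_decreasing_def
proof
  fix k :: nat
  obtain C where "C \<ge> 0" and f_le: "norm (f (y + r)) * (1 + \<bar>y\<bar>) ^ k \<le> C * (1 + \<bar>r\<bar>) ^ k" for y r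
    using rapidly_decreasing_shift_bound[OF assms(1)] by metis
  define M where "M = 1 + 1 / \<bar>a\<bar>"
  have "norm (c *\<^sub>R f (a * x + b)) * (1 + \<bar>x\<bar>) ^ k \<le> \<bar>c\<bar> * (C * (1 + \<bar>b\<bar>) ^ k * M ^ k)" for x
  proof -
    have "1 + \<bar>x\<bar> \<le> (1 + \<bar>a * x\<bar>) * M"
      using \<open>a \<noteq> 0\<close> by (simp add: M_def abs_mult field_simps)
    hence "norm (f (a * x + b)) * (1 + \<bar>x\<bar>) ^ k \<le> norm (f (a * x + b)) * ((1 + \<bar>a * x\<bar>) * M) ^ k"
      by (intro mult_left_mono power_mono) auto
    also have "\<dots> \<le> C * (1 + \<bar>b\<bar>) ^ k * M ^ k"
      unfolding power_mult_distrib mult.assoc[symmetric] by (intro mult_right_mono f_le) (simp add: M_def)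
    finally show ?thesis by (simp add: mult.assoc mult_left_mono)
  qed
  thus "\<exists>C. \<forall>x. norm (c *\<^sub>R f (a * x + b)) * (1 + \<bar>x\<bar>) ^ k \<le> C" by blast
qed

lemma schwartz_affine:
  assumes "schwartz f" "a \<noteq> 0"
  shows "schwartz (\<lambda>x. f (a * x + b))"
  using assms unfolding schwartz_iff_smooth_in
  by (auto elim!: smooth_in_affine intro: rapidly_decreasing_affine)

lemma schwartz_derivative:
  assumes "schwartz phi"
  obtains phi' where "schwartz phi'" "\<And>x. (phi has_vector_derivative phi' x) (at x)"
  using assms smooth_in_derivative unfolding schwartz_iff_smooth_in by blast

lemma schwartz_imp_rapidly_decreasing: "schwartz f \<Longrightarrow> rapidly_decreasing f"
  using smooth_inD unfolding schwartz_iff_smooth_in by blast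

lemma schwartz_imp_continuous_on: "schwartz f \<Longrightarrow> continuous_on S f"
  using smooth_in_continuous_on unfolding schwartz_iff_smooth_in by blast

subsection \<open>Bump functions\<close>

definition bump :: "real \<Rightarrow> (real \<Rightarrow> complex) set" where
  "bump e = smooth_in {f. \<forall>x. e \<le> \<bar>x\<bar> \<longrightarrow> f x = 0}"

lemma bump_mono: "e \<le> e' \<Longrightarrow> bump e \<subseteq> bump e'"
  unfolding bump_def by (intro smooth_in_mono) auto

lemma bump_eq_0: "b \<in> bump e \<Longrightarrow> e \<le> \<bar>x\<bar> \<Longrightarrow> b x = 0"
  using smooth_inD unfolding bump_def by blast

lemma bump_continuous_on: "b \<in> bump e \<Longrightarrow> continuous_on S b"
  unfolding bump_def by (rule smooth_in_continuous_on)

lemma bump_derivative: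
  assumes "b \<in> bump e"
  obtains b' where "b' \<in> bump e" "\<And>x. (b has_vector_derivative b' x) (at x)"
  using assms smooth_in_derivative unfolding bump_def by blast

lemma bump_times_holomorphic:
  assumes "b \<in> bump e" and A: "open A" "of_real ` {-e..e} \<subseteq> A" and h: "h holomorphic_on A"
  shows "(\<lambda>u. b u * h (of_real u)) \<in> bump e"
  using assms(1) unfolding bump_def
proof (rule smooth_in_mult)
  let ?G = "{\<lambda>u. h (complex_of_real u) | h. h holomorphic_on A}"
  show "(\<lambda>u. h (complex_of_real u)) \<in> ?G" using h by blast
  show "\<exists>g'\<in>?G. \<forall>x\<in>{-e..e}. (g has_vector_derivative g' x) (at x)" if "g \<in> ?G" for g
  proof -
    from that obtain h where g: "g = (\<lambda>u. h (complex_of_real u))" and h: "h holomorphic_on A" by auto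
    have "(g has_vector_derivative deriv h (of_real x)) (at x)" if "x \<in> {-e..e}" for x
      unfolding g using A that
      by (intro has_vector_derivative_real_field holomorphic_derivI[OF h \<open>open A\<close>]) auto
    moreover have "deriv h holomorphic_on A" by (rule holomorphic_deriv[OF h \<open>open A\<close>])
    ultimately show ?thesis by (intro bexI[of _ "\<lambda>u. deriv h (of_real u)"]) auto
  qed
  show "f x = 0" if "f \<in> {f. \<forall>x. e \<le> \<bar>x\<bar> \<longrightarrow> f x = 0}" "x \<notin> {-e..e}" for f x
    using that by auto
qed auto

definition flat :: "real poly \<Rightarrow> real \<Rightarrow> real" where
  "flat p x = (if x > 0 then poly p (1 / x) * exp (- (1 / x)) else 0)"

lemma poly_times_exp_minus_tendsto_0: "((\<lambda>x::real. poly p x * exp (- x)) \<longlongrightarrow> 0) at_top"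
proof -
  have "((\<lambda>x::real. \<Sum>i\<le>degree p. coeff p i * (x ^ i / exp x)) \<longlongrightarrow> 0) at_top"
    by (intro tendsto_null_sum tendsto_mult_right_zero tendsto_power_div_exp_0)
  thus ?thesis by (simp add: poly_altdef sum_divide_distrib exp_minus divide_inverse[symmetric])
qed

lemma flat_has_derivative:
  "(flat p has_real_derivative flat ([:0, 0, 1:] * (p - pderiv p)) x) (at x)"
proof -
  let ?q = "[:0, 0, 1:] * (p - pderiv p)"
  consider "x > 0" | "x < 0" | "x = 0" by linarith
  thus ?thesis
  proof cases
    case 1
    have "((\<lambda>x. poly p (1 / x) * exp (- (1 / x))) has_real_derivative flat ?q x) (at x)"
      using 1 by (auto intro!: derivative_eq_intros DERIV_chain2[OF poly_DERIV]
          simp: flat_def field_simps power2_eq_square)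
    thus ?thesis
      by (rule has_field_derivative_transform_within_open[of _ _ _ "{0<..}"]) (use 1 in \<open>auto simp: flat_def\<close>)
  next
    case 2
    have "(flat p has_real_derivative 0) (at x)"
      by (rule has_field_derivative_transform_within_open[of "\<lambda>_. 0" _ _ "{..<0}"])
         (use 2 in \<open>auto simp: flat_def\<close>)
    thus ?thesis using 2 by (simp add: flat_def)
  next
    case 3
    have "((\<lambda>h. poly (pCons 0 p) (1 / h) * exp (- (1 / h))) \<longlongrightarrow> 0) (at_right (0::real))"
      using poly_times_exp_minus_tendsto_0[of "pCons 0 p"]
      by (simp add: filterlim_at_right_to_top divide_inverse)
    hence "((\<lambda>h. flat p h / h) \<longlongrightarrow> 0) (at_right 0)"
      by (rule Lim_transform_eventually)
         (rule eventually_mono[OF eventually_at_right_less], simp add: flat_def)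
    moreover have "((\<lambda>h. flat p h / h) \<longlongrightarrow> 0) (at_left 0)"
      by (rule Lim_transform_eventually[OF tendsto_const])
         (auto simp: flat_def eventually_at_filter intro!: always_eventually)
    ultimately have "((\<lambda>h. flat p h / h) \<longlongrightarrow> 0) (at 0)" by (rule filterlim_split_at[rotated])
    thus ?thesis using 3 by (simp add: has_field_derivative_iff flat_def)
  qed
qed

lemma flat_smooth_in: "(\<lambda>x. complex_of_real (flat p x)) \<in> smooth_in {f. \<forall>x\<le>0. f x = 0}"
proof (rule smooth_in_coinduct)
  let ?A = "range (\<lambda>p x. complex_of_real (flat p x))"
  show "?A \<subseteq> {f. \<forall>x\<le>0. f x = 0}" by (auto simp: flat_def)
  show "\<exists>g'\<in>?A. \<forall>x. (g has_vector_derivative g' x) (at x)" if "g \<in> ?A" for g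
  proof -
    from that obtain p where "g = (\<lambda>x. complex_of_real (flat p x))" by auto
    hence "\<forall>x. (g has_vector_derivative of_real (flat ([:0, 0, 1:] * (p - pderiv p)) x)) (at x)"
      by (simp only: has_vector_derivative_of_real flat_has_derivative simp_thms)
    thus ?thesis by (intro bexI[OF _ rangeI])
  qed
qed blast

lemma bump_flat: "(\<lambda>x. complex_of_real (flat p (e + x) * flat q (e - x))) \<in> bump e"
proof -
  let ?R = "{f :: real \<Rightarrow> complex. \<forall>x\<ge>e. f x = 0}"
  have left: "(\<lambda>x. complex_of_real (flat p (1 * x + e))) \<in> smooth_in {f. \<forall>x\<le>-e. f x = 0}"
    by (rule smooth_in_affine[OF flat_smooth_in]) auto
  have right: "(\<lambda>x. complex_of_real (flat q (-1 * x + e))) \<in> smooth_in ?R"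
    by (rule smooth_in_affine[OF flat_smooth_in]) auto
  have "(\<lambda>x. complex_of_real (flat p (1 * x + e)) * complex_of_real (flat q (-1 * x + e))) \<in> bump e"
    unfolding bump_def
  proof (rule smooth_in_mult[OF left right, where X = UNIV])
    show "\<exists>g'\<in>smooth_in ?R. \<forall>x\<in>UNIV. (g has_vector_derivative g' x) (at x)"
      if "g \<in> smooth_in ?R" for g
      by (rule smooth_in_derivative[OF that], rule bexI) auto
    show "(\<lambda>x. f x * g x) \<in> {f. \<forall>x. e \<le> \<bar>x\<bar> \<longrightarrow> f x = 0}"
      if "f \<in> {f. \<forall>x\<le>-e. f x = 0}" "g \<in> smooth_in ?R" for f g
      using that(1) smooth_inD[OF that(2)] by (auto simp: abs_if)
  qed auto
  thus ?thesis by (simp add: add.commute)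
qed

lemma bump_exists:
  assumes "e > 0"
  obtains b where "b \<in> bump e" "b 0 \<noteq> 0" "integral {-e..e} b = 1"
proof -
  define w where "w x = flat 1 (e + x) * flat 1 (e - x)" for x
  define s where "s = integral {-e..e} w"
  define b where "b x = complex_of_real (w x) * of_real (1 / s)" for x
  have w: "(\<lambda>x. complex_of_real (w x)) \<in> bump e" unfolding w_def by (rule bump_flat)
  have "continuous_on {-e..e} (\<lambda>x. Re (complex_of_real (w x)))"
    by (intro continuous_intros bump_continuous_on[OF w])
  hence w_cont: "continuous_on {-e..e} w" by simp
  have "w x \<ge> 0" for x by (simp add: w_def flat_def)
  moreover have "w 0 > 0" using \<open>e > 0\<close> by (simp add: w_def flat_def)
  ultimately have "s \<noteq> 0"
    unfolding s_def using integral_eq_0_iff[OF w_cont] \<open>e > 0\<close> by force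
  hence "b 0 \<noteq> 0" using \<open>w 0 > 0\<close> by (simp add: b_def)
  moreover have "b \<in> bump e"
    unfolding b_def[abs_def]
    by (rule bump_times_holomorphic[OF w, of UNIV "\<lambda>_. of_real (1 / s)"]) auto
  moreover have "integral {-e..e} b = 1"
  proof -
    have "((\<lambda>x. complex_of_real (w x)) has_integral of_real s) {-e..e}"
      unfolding s_def by (intro has_integral_of_real integrable_integral integrable_continuous_interval w_cont)
    thus ?thesis using \<open>s \<noteq> 0\<close> by (simp add: b_def[abs_def] integral_unique)
  qed
  ultimately show thesis using that by blast
qed

section \<open>The Fourier transform\<close>

definition exp2pi :: "complex \<Rightarrow> complex" where
  "exp2pi z = exp (2 * of_real pi * \<i> * z)"

lemma exp2pi_0 [simp]: "exp2pi 0 = 1"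
  by (simp add: exp2pi_def)

lemma exp2pi_add: "exp2pi (z + w) = exp2pi z * exp2pi w"
  by (simp add: exp2pi_def distrib_left exp_add)

lemma norm_exp2pi: "norm (exp2pi z) = exp (- 2 * pi * Im z)"
  by (simp add: exp2pi_def norm_exp_eq_Re)

lemma norm_exp2pi_of_real [simp]: "norm (exp2pi (of_real x)) = 1" "norm (exp2pi (- of_real x)) = 1"
  by (simp_all add: norm_exp2pi)

lemma exp2pi_eq_1_iff: "exp2pi z = 1 \<longleftrightarrow> z \<in> \<int>"
proof -
  have "exp2pi z = 1 \<longleftrightarrow> Im z = 0 \<and> (\<exists>n::int. Re z = of_int n)"
    by (auto simp: exp2pi_def exp_eq_1)
  also have "\<dots> \<longleftrightarrow> z \<in> \<int>"
    by (auto simp: Ints_def complex_eq_iff)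
  finally show ?thesis .
qed

lemma exp2pi_has_field_derivative [derivative_intros]:
  assumes "(f has_field_derivative f') (at z within S)"
  shows "((\<lambda>z. exp2pi (f z)) has_field_derivative 2 * of_real pi * \<i> * f' * exp2pi (f z)) (at z within S)"
  unfolding exp2pi_def by (auto intro!: derivative_eq_intros assms)

lemma holomorphic_on_exp2pi [holomorphic_intros]:
  "f holomorphic_on S \<Longrightarrow> (\<lambda>z. exp2pi (f z)) holomorphic_on S"
  unfolding exp2pi_def by (intro holomorphic_intros)

lemma continuous_on_exp2pi [continuous_intros]:
  "continuous_on S f \<Longrightarrow> continuous_on S (\<lambda>x. exp2pi (f x))"
  unfolding exp2pi_def by (intro continuous_intros)

lemma borel_measurable_exp2pi [measurable]: "exp2pi \<in> borel_measurable borel"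
  by (intro borel_measurable_continuous_onI continuous_intros)

lemma integrable_exp2pi_mult:
  assumes f: "integrable M f" and g: "g \<in> borel_measurable M"
  shows "integrable M (\<lambda>x. exp2pi (of_real (g x)) * f x)"
  using f
proof (rule Bochner_Integration.integrable_bound)
  show "(\<lambda>x. exp2pi (of_real (g x)) * f x) \<in> borel_measurable M"
    using borel_measurable_integrable[OF f] g by measurable
qed (auto simp: norm_mult)

lemma fourier_eq_lborel:
  assumes f: "integrable lborel f"
  shows "fourier f t = (LINT x|lborel. exp2pi (of_real (- (t * x))) * f x)"
proof -
  have "integrable lborel (\<lambda>x. exp2pi (of_real (- (t * x))) * f x)"
    by (rule integrable_exp2pi_mult[OF f]) simp
  from integral_lborel[OF this] show ?thesis
    by (simp add: fourier_def exp2pi_def mult_ac)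
qed

lemma fourier_affine:
  assumes f: "integrable lborel f" and "a \<noteq> 0"
  shows "fourier (\<lambda>x. f (a * x + b)) t
    = of_real (1 / \<bar>a\<bar>) * exp2pi (of_real (t * b / a)) * fourier f (t / a)"
proof -
  have "integrable lborel (\<lambda>x. f (b + a * x))" using lborel_integrable_real_affine[OF f \<open>a \<noteq> 0\<close>, of b] .
  hence "fourier (\<lambda>x. f (a * x + b)) t = (LINT x|lborel. exp2pi (of_real (- (t * x))) * f (a * x + b))"
    by (intro fourier_eq_lborel) (simp add: add.commute)
  also have "\<dots> = (1 / \<bar>a\<bar>) *\<^sub>R (LINT x|lborel.
      exp2pi (of_real (- (t * (- b / a + 1 / a * x)))) * f (a * (- b / a + 1 / a * x) + b))"
    using \<open>a \<noteq> 0\<close> by (subst lborel_integral_real_affine[of "1 / a" _ "- b / a"]) auto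
  also have "(\<lambda>x. exp2pi (of_real (- (t * (- b / a + 1 / a * x)))) * f (a * (- b / a + 1 / a * x) + b))
      = (\<lambda>x. exp2pi (of_real (t * b / a)) * (exp2pi (of_real (- (t / a * x))) * f x))"
  proof
    fix x
    have "- (t * (- b / a + 1 / a * x)) = t * b / a + - (t / a * x)" "a * (- b / a + 1 / a * x) + b = x"
      using \<open>a \<noteq> 0\<close> by (auto simp: field_simps)
    thus "exp2pi (of_real (- (t * (- b / a + 1 / a * x)))) * f (a * (- b / a + 1 / a * x) + b)
        = exp2pi (of_real (t * b / a)) * (exp2pi (of_real (- (t / a * x))) * f x)"
      by (simp only: of_real_add exp2pi_add mult.assoc)
  qed
  finally show ?thesis
    by (simp add: fourier_eq_lborel[OF f] scaleR_conv_of_real)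
qed

lemma fourier_modulate:
  assumes f: "integrable lborel f"
  shows "fourier (\<lambda>x. exp2pi (of_real (s * x)) * f x) t = fourier f (t - s)"
proof -
  have "exp2pi (of_real (- (t * x))) * exp2pi (of_real (s * x)) = exp2pi (of_real (- ((t - s) * x)))" for x
    by (simp add: exp2pi_add[symmetric] algebra_simps)
  moreover have "integrable lborel (\<lambda>x. exp2pi (of_real (s * x)) * f x)"
    by (rule integrable_exp2pi_mult[OF f]) simp
  ultimately show ?thesis
    by (simp only: fourier_eq_lborel f mult.assoc[symmetric])
qed

lemma fourier_multiplication_formula:
  assumes f: "integrable lborel f" and g: "integrable lborel g"
  shows "(LINT t|lborel. fourier f t * g t) = (LINT y|lborel. f y * fourier g y)"
proof -
  define h where "h = (\<lambda>(t::real, y::real). exp2pi (of_real (- (t * y))) * (f y * g t))"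
  have "integrable (lborel \<Otimes>\<^sub>M lborel) h"
  proof (rule lborel_pair.Fubini_integrable)
    note [measurable] = borel_measurable_integrable[OF f] borel_measurable_integrable[OF g]
    show "h \<in> borel_measurable (lborel \<Otimes>\<^sub>M lborel)"
      unfolding h_def by measurable
    show "integrable lborel (\<lambda>t. LINT y|lborel. norm (h (t, y)))"
      using integrable_norm[OF g] by (simp add: h_def norm_mult del: of_real_mult of_real_minus)
    show "AE t in lborel. integrable lborel (\<lambda>y. h (t, y))"
      unfolding h_def by (auto intro!: AE_I2 integrable_exp2pi_mult f simp del: of_real_mult of_real_minus)
  qed
  hence "(LINT y|lborel. LINT t|lborel. h (t, y)) = (LINT t|lborel. LINT y|lborel. h (t, y))"
    using lborel_pair.Fubini_integral[of "\<lambda>t y. h (t, y)"] by simp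
  moreover have "(LINT y|lborel. h (t, y)) = fourier f t * g t" for t
    by (simp add: h_def fourier_eq_lborel[OF f] mult.assoc[symmetric] del: of_real_mult of_real_minus)
  moreover have "(LINT t|lborel. h (t, y)) = f y * fourier g y" for y
  proof -
    have "h (t, y) = f y * (exp2pi (of_real (- (y * t))) * g t)" for t
      by (simp add: h_def mult_ac)
    thus ?thesis by (simp add: fourier_eq_lborel[OF g] del: of_real_mult of_real_minus)
  qed
  ultimately show ?thesis by simp
qed

definition gaussian :: "real \<Rightarrow> complex" where
  "gaussian x = of_real (exp (- pi * x\<^sup>2))"

lemma gaussian_eq_std_normal_density:
  "gaussian x = of_real (sqrt (2 * pi) * std_normal_density (sqrt (2 * pi) * x))"
  by (simp add: gaussian_def std_normal_density_def power_mult_distrib)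

lemma integrable_gaussian: "integrable lborel gaussian"
proof -
  have "integrable lborel (\<lambda>x. std_normal_density (0 + sqrt (2 * pi) * x))"
    by (rule lborel_integrable_real_affine) auto
  thus ?thesis unfolding gaussian_eq_std_normal_density[abs_def] by simp
qed

lemma fourier_gaussian: "fourier gaussian t = gaussian t"
proof -
  define c where "c = sqrt (2 * pi)"
  have "c > 0" "c\<^sup>2 = 2 * pi" by (simp_all add: c_def)
  have "gaussian t = char std_normal_distribution (- c * t)"
    by (simp add: gaussian_def char_std_normal_distribution power_mult_distrib \<open>c\<^sup>2 = 2 * pi\<close>)
  also have "\<dots> = (LINT x|lborel. std_normal_density x *\<^sub>R iexp (- c * t * x))"
    unfolding char_def by (rule integral_density) auto
  also have "\<dots> = c *\<^sub>R (LINT x|lborel. std_normal_density (c * x) *\<^sub>R iexp (- c * t * (c * x)))"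
    using \<open>c > 0\<close> by (subst lborel_integral_real_affine[of c _ 0]) auto
  also have "\<dots> = (LINT x|lborel. exp2pi (of_real (- (t * x))) * gaussian x)"
  proof -
    have "- c * t * (c * x) = - (2 * pi * (t * x))" for x
      unfolding \<open>c\<^sup>2 = 2 * pi\<close>[symmetric] by (simp add: power2_eq_square)
    hence "iexp (- c * t * (c * x)) = exp2pi (of_real (- (t * x)))" for x
      by (simp only: exp2pi_def) (simp add: mult_ac)
    thus ?thesis
      unfolding gaussian_eq_std_normal_density c_def[symmetric]
      by (simp add: scaleR_conv_of_real mult_ac flip: integral_mult_right_zero)
  qed
  finally show ?thesis by (simp add: fourier_eq_lborel integrable_gaussian)
qed

lemma approximate_identity:
  fixes g k :: "real \<Rightarrow> complex"
  assumes g: "continuous_on UNIV g" "\<And>x. norm (g x) \<le> A * (1 + \<bar>x\<bar>) ^ N"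
    and k: "k \<in> borel_measurable lborel" "integrable lborel (\<lambda>v. (1 + \<bar>v\<bar>) ^ N * norm (k v))"
  shows "(\<lambda>n. LINT v|lborel. g (x + v / real (Suc n)) * k v) \<longlonglongrightarrow> g x * (LINT v|lborel. k v)"
proof -
  have "0 \<le> A" using order_trans[OF norm_ge_zero g(2)[of 0]] by simp
  have "g \<in> borel_measurable borel" by (rule borel_measurable_continuous_onI[OF g(1)])
  note [measurable] = this k(1)
  have "(\<lambda>n. LINT v|lborel. g (x + v / real (Suc n)) * k v) \<longlonglongrightarrow> (LINT v|lborel. g x * k v)"
  proof (rule integral_dominated_convergence)
    show "integrable lborel (\<lambda>v. A * (1 + \<bar>x\<bar>) ^ N * ((1 + \<bar>v\<bar>) ^ N * norm (k v)))"
      by (intro integrable_mult_right k)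
    show "AE v in lborel. (\<lambda>n. g (x + v / real (Suc n)) * k v) \<longlonglongrightarrow> g x * k v"
    proof (rule AE_I2)
      fix v
      have "(\<lambda>n. x + v / real (Suc n)) \<longlonglongrightarrow> x" by real_asymp
      moreover have "isCont g x" using g(1) by (simp add: continuous_on_eq_continuous_at)
      ultimately have "(\<lambda>n. g (x + v / real (Suc n))) \<longlonglongrightarrow> g x" by (rule isCont_tendsto_compose[rotated])
      thus "(\<lambda>n. g (x + v / real (Suc n)) * k v) \<longlonglongrightarrow> g x * k v" by (intro tendsto_intros)
    qed
    show "AE v in lborel. norm (g (x + v / real (Suc n)) * k v)
        \<le> A * (1 + \<bar>x\<bar>) ^ N * ((1 + \<bar>v\<bar>) ^ N * norm (k v))" for n
    proof (rule AE_I2)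
      fix v
      have "1 + \<bar>x + v / real (Suc n)\<bar> \<le> (1 + \<bar>x\<bar>) * (1 + \<bar>v / real (Suc n)\<bar>)"
        using one_plus_norm_add_le[of x "v / real (Suc n)"] by simp
      also have "\<dots> \<le> (1 + \<bar>x\<bar>) * (1 + \<bar>v\<bar>)"
        by (intro mult_left_mono add_left_mono) (auto simp: abs_mult field_simps)
      finally have "norm (g (x + v / real (Suc n))) \<le> A * ((1 + \<bar>x\<bar>) * (1 + \<bar>v\<bar>)) ^ N"
        using \<open>0 \<le> A\<close> by (intro order_trans[OF g(2)] mult_left_mono power_mono) auto
      thus "norm (g (x + v / real (Suc n)) * k v) \<le> A * (1 + \<bar>x\<bar>) ^ N * ((1 + \<bar>v\<bar>) ^ N * norm (k v))"
        unfolding norm_mult mult.assoc[symmetric] power_mult_distrib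
        by (intro mult_right_mono) (simp_all add: mult_ac)
    qed
  qed auto
  thus ?thesis by simp
qed

lemma integrable_modulated_gaussian:
  assumes "a > 0"
  shows "integrable lborel (\<lambda>t. exp2pi (of_real (x * t)) * gaussian (t / a))"
proof -
  have "integrable lborel (\<lambda>t. gaussian (0 + 1 / a * t))"
    by (rule lborel_integrable_real_affine[OF integrable_gaussian]) (use assms in simp)
  thus ?thesis by (intro integrable_exp2pi_mult) simp_all
qed

lemma fourier_modulated_gaussian:
  assumes "a > 0"
  shows "fourier (\<lambda>t. exp2pi (of_real (x * t)) * gaussian (t / a)) y = of_real a * gaussian (a * (y - x))"
proof -
  have "fourier (\<lambda>t. exp2pi (of_real (x * t)) * gaussian (t / a)) y = fourier (\<lambda>t. gaussian (t / a)) (y - x)"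
    using integrable_modulated_gaussian[OF assms, of 0] by (intro fourier_modulate) simp
  also have "\<dots> = of_real a * gaussian (a * (y - x))"
    using fourier_affine[OF integrable_gaussian, of "1 / a" 0 "y - x"] assms
    by (simp add: fourier_gaussian mult.commute)
  finally show ?thesis .
qed

text \<open>
  The multiplication formula against \<open>t \<mapsto> exp (2 \<pi> i x t - \<pi> (t / a)\<^sup>2)\<close>, whose transform is an
  approximate identity at \<open>x\<close> as \<open>a \<rightarrow> \<infinity>\<close>.
\<close>

lemma integral_fourier_times_modulated_gaussian:
  assumes f: "integrable lborel f" and "a > 0"
  shows "(LINT t|lborel. fourier f t * (exp2pi (of_real (x * t)) * gaussian (t / a)))
    = (LINT v|lborel. f (x + v / a) * gaussian v)"
proof -
  have "(LINT t|lborel. fourier f t * (exp2pi (of_real (x * t)) * gaussian (t / a)))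
      = (LINT y|lborel. f y * (of_real a * gaussian (a * (y - x))))"
    by (simp only: fourier_multiplication_formula[OF f integrable_modulated_gaussian[OF \<open>a > 0\<close>]]
        fourier_modulated_gaussian[OF \<open>a > 0\<close>])
  also have "\<dots> = (1 / a) *\<^sub>R (LINT v|lborel. of_real a * (f (x + v / a) * gaussian v))"
    using \<open>a > 0\<close> by (subst lborel_integral_real_affine[of "1 / a" _ x]) (auto simp: mult_ac)
  also have "\<dots> = (LINT v|lborel. f (x + v / a) * gaussian v)"
    using \<open>a > 0\<close> by (simp add: scaleR_conv_of_real)
  finally show ?thesis .
qed

lemma integral_times_dilated_gaussian_tendsto:
  assumes g: "integrable lborel g"
  shows "(\<lambda>n. LINT t|lborel. g t * gaussian (t / real (Suc n))) \<longlonglongrightarrow> (LINT t|lborel. g t)"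
proof (rule integral_dominated_convergence)
  have [measurable]: "gaussian \<in> borel_measurable borel" "g \<in> borel_measurable borel"
    using borel_measurable_integrable[OF integrable_gaussian] borel_measurable_integrable[OF g] by simp_all
  show "(\<lambda>t. g t * gaussian (t / real (Suc n))) \<in> borel_measurable lborel" "g \<in> borel_measurable lborel" for n
    by measurable
  show "integrable lborel (\<lambda>t. norm (g t))" by (rule integrable_norm[OF g])
  have "(\<lambda>n. g t * gaussian (t / real (Suc n))) \<longlonglongrightarrow> g t" for t
  proof -
    have "(\<lambda>n. t / real (Suc n)) \<longlonglongrightarrow> 0" by real_asymp
    hence "(\<lambda>n. gaussian (t / real (Suc n))) \<longlonglongrightarrow> of_real (exp (- pi * 0\<^sup>2))"
      unfolding gaussian_def by (intro tendsto_intros)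
    from tendsto_mult_left[OF this, of "g t"] show ?thesis by simp
  qed
  thus "AE t in lborel. (\<lambda>n. g t * gaussian (t / real (Suc n))) \<longlonglongrightarrow> g t" by (rule AE_I2)
  have "norm (gaussian t) \<le> 1" for t by (simp add: gaussian_def)
  thus "AE t in lborel. norm (g t * gaussian (t / real (Suc n))) \<le> norm (g t)" for n
    by (auto simp only: norm_mult intro!: AE_I2 mult_left_le norm_ge_zero)
qed

theorem fourier_inversion:
  assumes f: "integrable lborel f" "continuous_on UNIV f" "\<And>y. norm (f y) \<le> B"
    and f_hat: "integrable lborel (fourier f)"
  shows "(LINT t|lborel. exp2pi (of_real (x * t)) * fourier f t) = f x"
proof -
  define I where "I n = (LINT t|lborel. fourier f t * (exp2pi (of_real (x * t)) * gaussian (t / real (Suc n))))"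
    for n
  have "(LINT v|lborel. gaussian v) = 1"
    using fourier_gaussian[of 0] fourier_eq_lborel[OF integrable_gaussian, of 0] by (simp add: gaussian_def)
  moreover have "(\<lambda>n. LINT v|lborel. f (x + v / real (Suc n)) * gaussian v) \<longlonglongrightarrow> f x * (LINT v|lborel. gaussian v)"
    using f integrable_gaussian by (intro approximate_identity[where A = B and N = 0]) auto
  ultimately have "I \<longlonglongrightarrow> f x"
    unfolding I_def[abs_def]
    by (simp add: integral_fourier_times_modulated_gaussian[OF f(1)] del: of_nat_Suc of_real_mult)
  moreover have "I = (\<lambda>n. LINT t|lborel. exp2pi (of_real (x * t)) * fourier f t * gaussian (t / real (Suc n)))"
    unfolding I_def by (simp only: mult_ac)
  moreover have "integrable lborel (\<lambda>t. exp2pi (of_real (x * t)) * fourier f t)"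
    by (rule integrable_exp2pi_mult[OF f_hat]) simp
  ultimately show ?thesis
    using LIMSEQ_unique[OF integral_times_dilated_gaussian_tendsto] by simp
qed

subsection \<open>Pairings with functions of polynomial growth\<close>

lemma poly_growthE:
  assumes "f \<in> poly_growth_space"
  obtains A N where "A \<ge> 0" "\<And>x. norm (f x) \<le> A * (1 + \<bar>x\<bar>) ^ N"
proof -
  obtain A N where f_le: "norm (f x) \<le> A * (1 + \<bar>x\<bar>) ^ N" for x
    using assms unfolding poly_growth_space_def by blast
  moreover have "0 \<le> A" using order_trans[OF norm_ge_zero f_le[of 0]] by simp
  ultimately show thesis using that by blast
qed

lemma poly_growth_continuous_on: "f \<in> poly_growth_space \<Longrightarrow> continuous_on UNIV f"
  by (simp add: poly_growth_space_def)

lemma exp2pi_in_poly_growth_space: "(\<lambda>x. exp2pi (of_real (a * x))) \<in> poly_growth_space"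
  unfolding poly_growth_space_def
  by (intro CollectI conjI continuous_intros exI[of _ 1] exI[of _ 0]) (simp del: of_real_mult)

lemma integrable_inverse_square: "integrable lborel (\<lambda>x::real. 1 / (1 + \<bar>x\<bar>)\<^sup>2)"
proof (rule Bochner_Integration.integrable_bound)
  show "integrable lborel (\<lambda>x::real. inverse (1 + x\<^sup>2))"
    using integrable_inverse_1_plus_square by (simp add: set_integrable_def)
  have "1 / (1 + \<bar>x\<bar>)\<^sup>2 \<le> inverse (1 + x\<^sup>2)" for x :: real
    unfolding inverse_eq_divide
    by (intro divide_left_mono mult_pos_pos) (auto simp: power2_eq_square algebra_simps intro: add_pos_nonneg)
  thus "AE x in lborel. norm (1 / (1 + \<bar>x::real\<bar>)\<^sup>2) \<le> norm (inverse (1 + x\<^sup>2))" by simp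
qed simp

lemma poly_growth_times_shift_bound:
  assumes "f \<in> poly_growth_space" "rapidly_decreasing phi"
  obtains C m where "C \<ge> 0" "\<And>x r. norm (f x * phi (x + r)) \<le> C * (1 + \<bar>r\<bar>) ^ m * (1 / (1 + \<bar>x\<bar>)\<^sup>2)"
proof -
  obtain A N where "A \<ge> 0" and f_le: "\<And>x. norm (f x) \<le> A * (1 + \<bar>x\<bar>) ^ N"
    using poly_growthE[OF assms(1)] by blast
  obtain D where "D \<ge> 0" and phi_le: "norm (phi (x + r)) * (1 + \<bar>x\<bar>) ^ (N + 2) \<le> D * (1 + \<bar>r\<bar>) ^ (N + 2)" for x r
    using rapidly_decreasing_shift_bound[OF assms(2), of "N + 2"] by blast
  have "norm (f x * phi (x + r)) \<le> A * D * (1 + \<bar>r\<bar>) ^ (N + 2) * (1 / (1 + \<bar>x\<bar>)\<^sup>2)" for x r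
  proof -
    have "norm (f x * phi (x + r)) * (1 + \<bar>x\<bar>)\<^sup>2 \<le> (A * (1 + \<bar>x\<bar>) ^ N * norm (phi (x + r))) * (1 + \<bar>x\<bar>)\<^sup>2"
      unfolding norm_mult by (intro mult_right_mono f_le) auto
    also have "\<dots> = A * (norm (phi (x + r)) * (1 + \<bar>x\<bar>) ^ (N + 2))"
      by (simp only: power_add mult_ac)
    also have "\<dots> \<le> A * (D * (1 + \<bar>r\<bar>) ^ (N + 2))" by (rule mult_left_mono[OF phi_le \<open>A \<ge> 0\<close>])
    finally show ?thesis by (simp add: pos_le_divide_eq mult.assoc)
  qed
  thus thesis using that[of "A * D" "N + 2"] \<open>A \<ge> 0\<close> \<open>D \<ge> 0\<close> by simp
qed

lemma integrable_poly_growth_times_schwartz: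
  assumes f: "f \<in> poly_growth_space" and phi: "schwartz phi"
  shows "integrable lborel (\<lambda>x. f x * phi x)"
proof -
  obtain C m where "C \<ge> 0"
    and product_le: "\<And>x r. norm (f x * phi (x + r)) \<le> C * (1 + \<bar>r\<bar>) ^ m * (1 / (1 + \<bar>x\<bar>)\<^sup>2)"
    using poly_growth_times_shift_bound[OF f schwartz_imp_rapidly_decreasing[OF phi]] by metis
  show ?thesis
  proof (rule Bochner_Integration.integrable_bound)
    show "integrable lborel (\<lambda>x::real. C * (1 / (1 + \<bar>x\<bar>)\<^sup>2))"
      by (intro integrable_mult_right integrable_inverse_square)
    have "continuous_on UNIV (\<lambda>x. f x * phi x)"
      by (intro continuous_intros poly_growth_continuous_on[OF f] schwartz_imp_continuous_on[OF phi])
    thus "(\<lambda>x. f x * phi x) \<in> borel_measurable lborel" by (simp add: borel_measurable_continuous_onI)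
    show "AE x in lborel. norm (f x * phi x) \<le> norm (C * (1 / (1 + \<bar>x\<bar>)\<^sup>2))"
      using product_le[of _ 0] \<open>C \<ge> 0\<close> by (auto intro!: AE_I2)
  qed
qed

lemma integrable_schwartz: "schwartz phi \<Longrightarrow> integrable lborel phi"
  using integrable_poly_growth_times_schwartz[OF exp2pi_in_poly_growth_space[of 0]] by simp

lemma integral_poly_growth_times_schwartz:
  assumes "f \<in> poly_growth_space" "schwartz phi"
  shows "integral UNIV (\<lambda>x. f x * phi x) = (LINT x|lborel. f x * phi x)"
  by (rule integral_lborel[OF integrable_poly_growth_times_schwartz[OF assms]])

lemma integrable_weighted_schwartz:
  assumes "schwartz phi"
  shows "integrable lborel (\<lambda>x. (1 + \<bar>x\<bar>) ^ N * norm (phi x))"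
proof -
  have "(\<lambda>x. complex_of_real ((1 + \<bar>x\<bar>) ^ N)) \<in> poly_growth_space"
    unfolding poly_growth_space_def
    by (intro CollectI conjI continuous_intros exI[of _ 1] exI[of _ N])
       (simp del: of_real_power of_real_add)
  from integrable_norm[OF integrable_poly_growth_times_schwartz[OF this assms]] show ?thesis
    by (simp add: norm_mult del: of_real_power of_real_add)
qed

lemma schwartz_bounded:
  assumes "schwartz phi"
  obtains B where "\<And>x. norm (phi x) \<le> B"
  using rapidly_decreasingE[OF schwartz_imp_rapidly_decreasing[OF assms], where k = 0] by (metis mult_1_right power_0)

lemma schwartz_in_poly_growth_space:
  assumes "schwartz phi"
  shows "phi \<in> poly_growth_space"
proof -
  obtain B where "\<And>x. norm (phi x) \<le> B" using schwartz_bounded[OF assms] by blast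
  thus ?thesis
    unfolding poly_growth_space_def
    by (intro CollectI conjI schwartz_imp_continuous_on[OF assms] exI[of _ B] exI[of _ 0]) simp
qed

lemma schwartz_eq_0_of_fourier_eq_0:
  assumes phi: "schwartz phi" and "\<And>t. fourier phi t = 0"
  shows "phi x = 0"
proof -
  have fourier_phi: "fourier phi = (\<lambda>_. 0)" using assms(2) by blast
  obtain B where "norm (phi y) \<le> B" for y
    using schwartz_bounded[OF phi] by blast
  hence "(LINT t|lborel. exp2pi (of_real (x * t)) * fourier phi t) = phi x"
    by (intro fourier_inversion[where B = B] integrable_schwartz[OF phi] schwartz_imp_continuous_on[OF phi])
       (simp_all add: fourier_phi)
  thus ?thesis by (simp add: fourier_phi)
qed

section \<open>Fourier transforms of functions on an interval\<close>

definition interval_ft :: "real \<Rightarrow> real \<Rightarrow> (real \<Rightarrow> complex) \<Rightarrow> complex \<Rightarrow> complex" where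
  "interval_ft a b f z = integral {a..b} (\<lambda>u. f u * exp2pi (- (z * of_real u)))"

lemma interval_ft_0: "interval_ft a b f 0 = integral {a..b} f"
  by (simp add: interval_ft_def)

lemma interval_ft_integrable_on:
  "continuous_on {a..b} f \<Longrightarrow> (\<lambda>u. f u * exp2pi (- (z * of_real u))) integrable_on {a..b}"
  by (intro integrable_continuous_interval continuous_intros)

lemma interval_ft_combine:
  assumes "a \<le> b" "b \<le> c" "continuous_on {a..c} f"
  shows "interval_ft a b f z + interval_ft b c f z = interval_ft a c f z"
  unfolding interval_ft_def
  using assms by (intro Henstock_Kurzweil_Integration.integral_combine interval_ft_integrable_on)

lemma interval_ft_has_field_derivative:
  assumes f: "continuous_on {a..b} f"
  shows "(interval_ft a b f has_field_derivative interval_ft a b (\<lambda>u. - 2 * of_real pi * \<i> * of_real u * f u) z) (at z)"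
proof -
  have "((\<lambda>z. integral (cbox a b) (\<lambda>u. f u * exp2pi (- (z * of_real u)))) has_field_derivative
      integral (cbox a b) (\<lambda>u. (- 2 * of_real pi * \<i> * of_real u * f u) * exp2pi (- (z * of_real u))))
      (at z within UNIV)"
  proof (rule leibniz_rule_field_derivative)
    have "continuous_on (UNIV \<times> cbox a b) (\<lambda>x. f (snd x))"
      by (rule continuous_on_compose2[OF f]) (auto intro!: continuous_intros)
    thus "continuous_on (UNIV \<times> cbox a b)
        (\<lambda>(z, u). (- 2 * of_real pi * \<i> * of_real u * f u) * exp2pi (- (z * of_real u)))"
      unfolding split_beta by (intro continuous_intros)
  qed (use f in \<open>auto intro!: derivative_eq_intros interval_ft_integrable_on\<close>)
  thus ?thesis unfolding interval_ft_def by simp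
qed

lemma holomorphic_interval_ft: "continuous_on {a..b} f \<Longrightarrow> interval_ft a b f holomorphic_on S"
  by (meson interval_ft_has_field_derivative field_differentiable_at_within field_differentiable_def
      holomorphic_on_def)

lemma norm_interval_ft_le:
  assumes "a \<le> b" and f: "continuous_on {a..b} f" "\<And>u. u \<in> {a..b} \<Longrightarrow> norm (f u) \<le> M"
  shows "norm (interval_ft a b f z) \<le> M * (b - a) * exp (pi * ((a + b) * Im z + (b - a) * \<bar>Im z\<bar>))"
proof -
  have "norm (interval_ft a b f z) \<le> (M * exp (pi * ((a + b) * Im z + (b - a) * \<bar>Im z\<bar>))) * (b - a)"
    unfolding interval_ft_def
  proof (rule integral_bound)
    fix u assume u: "u \<in> {a..b}"
    have "(2 * u - (a + b)) * Im z \<le> \<bar>2 * u - (a + b)\<bar> * \<bar>Im z\<bar>"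
      by (metis abs_ge_self abs_mult)
    also have "\<dots> \<le> (b - a) * \<bar>Im z\<bar>"
      using u by (intro mult_right_mono) auto
    finally have "2 * u * Im z \<le> (a + b) * Im z + (b - a) * \<bar>Im z\<bar>" by (simp add: left_diff_distrib)
    hence "pi * (2 * u * Im z) \<le> pi * ((a + b) * Im z + (b - a) * \<bar>Im z\<bar>)" by (intro mult_left_mono) auto
    hence "norm (exp2pi (- (z * of_real u))) \<le> exp (pi * ((a + b) * Im z + (b - a) * \<bar>Im z\<bar>))"
      unfolding norm_exp2pi by (simp add: mult_ac)
    thus "norm (f u * exp2pi (- (z * of_real u))) \<le> M * exp (pi * ((a + b) * Im z + (b - a) * \<bar>Im z\<bar>))"
      unfolding norm_mult using f(2)[OF u] by (intro mult_mono order_trans[OF norm_ge_zero f(2)[OF u]]) auto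
  qed (use assms in \<open>auto intro!: continuous_intros\<close>)
  thus ?thesis by (simp add: mult_ac)
qed

lemma interval_ft_1_of_int:
  assumes "a < b"
  shows "interval_ft a b (\<lambda>_. 1) (of_int n / of_real (b - a)) = (if n = 0 then of_real (b - a) else 0)"
proof (cases "n = 0")
  case True
  thus ?thesis using assms by (simp add: interval_ft_0 scaleR_conv_of_real)
next
  case False
  define z :: complex where "z = of_int n / of_real (b - a)"
  define F where "F u = exp2pi (- (z * of_real u)) / (- (2 * of_real pi * \<i> * z))" for u
  have "z \<noteq> 0" using False assms by (simp add: z_def)
  have "((\<lambda>u. exp2pi (- (z * of_real u))) has_integral F b - F a) {a..b}"
  proof (rule fundamental_theorem_of_calculus)
    show "(F has_vector_derivative exp2pi (- (z * of_real u))) (at u within {a..b})" for u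
      unfolding F_def
      by (rule has_vector_derivative_at_within, rule has_vector_derivative_real_field)
         (use \<open>z \<noteq> 0\<close> in \<open>auto intro!: derivative_eq_intros\<close>)
  qed (use assms in simp)
  moreover have "exp2pi (- (z * of_real b)) = exp2pi (- (z * of_real a))"
  proof -
    have "z * of_real (b - a) = of_int n" using assms by (simp add: z_def del: of_real_diff)
    hence "- (z * of_real b) = - (z * of_real a) + of_int (- n)" by (simp add: algebra_simps)
    moreover have "exp2pi (of_int (- n)) = 1" by (simp only: exp2pi_eq_1_iff Ints_of_int)
    ultimately show ?thesis by (simp only: exp2pi_add mult_1_right)
  qed
  ultimately show ?thesis using False by (simp add: interval_ft_def F_def z_def integral_unique)
qed

lemma interval_ft_bump_derivative:
  assumes b: "b \<in> bump e" and b': "b' \<in> bump e" "\<And>x. (b has_vector_derivative b' x) (at x)" and "e \<ge> 0"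
  shows "interval_ft (-e) e b' z = 2 * of_real pi * \<i> * z * interval_ft (-e) e b z"
proof -
  define F where "F u = b u * exp2pi (- (z * of_real u))" for u
  define F' where "F' u = b u * (- (2 * of_real pi * \<i> * z) * exp2pi (- (z * of_real u)))
    + b' u * exp2pi (- (z * of_real u))" for u
  have "(F' has_integral F e - F (- e)) {-e..e}"
  proof (rule fundamental_theorem_of_calculus)
    fix x
    have "((\<lambda>u. exp2pi (- (z * of_real u))) has_vector_derivative
        - (2 * of_real pi * \<i> * z) * exp2pi (- (z * of_real x))) (at x)"
      by (rule has_vector_derivative_real_field) (auto intro!: derivative_eq_intros)
    from has_vector_derivative_mult[OF b'(2) this]
    show "(F has_vector_derivative F' x) (at x within {-e..e})"
      unfolding F_def F'_def by (rule has_vector_derivative_at_within)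
  qed (use \<open>e \<ge> 0\<close> in simp)
  moreover have "F e - F (- e) = 0" using bump_eq_0[OF b] \<open>e \<ge> 0\<close> by (simp add: F_def)
  ultimately have F': "(F' has_integral 0) {-e..e}" by simp
  have "((\<lambda>u. 2 * of_real pi * \<i> * z * (b u * exp2pi (- (z * of_real u)))) has_integral
      2 * of_real pi * \<i> * z * interval_ft (-e) e b z) {-e..e}"
    unfolding interval_ft_def
    by (intro has_integral_mult_right integrable_integral interval_ft_integrable_on bump_continuous_on[OF b])
  from has_integral_add[OF F' this] show ?thesis
    by (simp add: F'_def interval_ft_def integral_unique)
qed

lemma bump_bounded:
  assumes "b \<in> bump e"
  obtains M where "M \<ge> 0" "\<And>x. norm (b x) \<le> M"
proof -
  have "compact (b ` {-e..e})" by (intro compact_continuous_image bump_continuous_on[OF assms]) simp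
  then obtain M where "M > 0" and b_le: "\<And>x. x \<in> {-e..e} \<Longrightarrow> norm (b x) \<le> M"
    by (metis bounded_pos compact_imp_bounded imageI)
  have "norm (b x) \<le> M" for x
    using \<open>M > 0\<close> b_le bump_eq_0[OF assms, of x] by (cases "x \<in> {-e..e}") auto
  thus thesis using that[of M] \<open>M > 0\<close> by simp
qed

lemma interval_ft_bump_decay:
  assumes "b \<in> bump e" and e: "e \<ge> 0"
  shows "\<exists>C\<ge>0. \<forall>z. norm (interval_ft (-e) e b z) * (1 + norm z) ^ k \<le> C * exp (2 * pi * e * \<bar>Im z\<bar>)"
  using assms(1)
proof (induction k arbitrary: b)
  case 0
  obtain M where "M \<ge> 0" and b_le: "\<And>x. norm (b x) \<le> M" using bump_bounded[OF 0] by blast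
  have "norm (interval_ft (-e) e b z) \<le> (M * (2 * e)) * exp (2 * pi * e * \<bar>Im z\<bar>)" for z
    using norm_interval_ft_le[of "-e" e b M z] e b_le bump_continuous_on[OF 0] by (simp add: mult_ac)
  thus ?case using \<open>M \<ge> 0\<close> e by (intro exI[of _ "M * (2 * e)"]) simp
next
  case (Suc k)
  let ?B = "interval_ft (-e) e b" and ?X = "\<lambda>z. exp (2 * pi * e * \<bar>Im z\<bar>)"
  obtain b' where b': "b' \<in> bump e" "\<And>x. (b has_vector_derivative b' x) (at x)"
    using bump_derivative[OF Suc.prems] by blast
  let ?B' = "interval_ft (-e) e b'"
  obtain C where "C \<ge> 0" and B_le: "\<And>z. norm (?B z) * (1 + norm z) ^ k \<le> C * ?X z"
    using Suc.IH[OF Suc.prems] by blast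
  obtain D where "D \<ge> 0" and B'_le: "\<And>z. norm (?B' z) * (1 + norm z) ^ k \<le> D * ?X z"
    using Suc.IH[OF b'(1)] by blast
  have "norm (?B z) * (1 + norm z) ^ Suc k \<le> (C + D) * ?X z" for z
  proof -
    have "1 * (norm z * norm (?B z)) \<le> 2 * pi * (norm z * norm (?B z))"
      using pi_gt3 by (intro mult_right_mono) auto
    also have "\<dots> = norm (?B' z)"
      unfolding interval_ft_bump_derivative[OF Suc.prems b' e] by (simp add: norm_mult)
    finally have "(norm z * norm (?B z)) * (1 + norm z) ^ k \<le> norm (?B' z) * (1 + norm z) ^ k"
      by (intro mult_right_mono) auto
    moreover have "norm (?B z) * (1 + norm z) ^ Suc k
        = norm (?B z) * (1 + norm z) ^ k + (norm z * norm (?B z)) * (1 + norm z) ^ k"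
      by (simp add: algebra_simps)
    ultimately show ?thesis using B_le[of z] B'_le[of z] by (simp add: distrib_right)
  qed
  thus ?case using \<open>C \<ge> 0\<close> \<open>D \<ge> 0\<close> by (intro exI[of _ "C + D"]) auto
qed

section \<open>Fourier transforms of bump functions\<close>

lemma fourier_bump_eq_interval_ft:
  assumes b: "b \<in> bump e"
  shows "fourier b t = interval_ft (-e) e b (of_real t)"
proof -
  have "integral UNIV (\<lambda>u. b u * exp2pi (- (of_real t * of_real u)))
      = integral UNIV (\<lambda>u. if u \<in> {-e..e} then b u * exp2pi (- (of_real t * of_real u)) else 0)"
    using bump_eq_0[OF b] by (intro Henstock_Kurzweil_Integration.integral_cong) auto
  also have "\<dots> = interval_ft (-e) e b (of_real t)"
    by (simp only: integral_restrict_UNIV interval_ft_def)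
  finally show ?thesis by (simp add: fourier_def exp2pi_def mult_ac)
qed

lemma rapidly_decreasing_fourier_bump:
  assumes "b \<in> bump e"
  shows "rapidly_decreasing (fourier b)"
  unfolding rapidly_decreasing_def
proof
  fix k
  have b: "b \<in> bump \<bar>e\<bar>" using assms bump_mono[OF abs_ge_self] by blast
  obtain C where "\<And>z. norm (interval_ft (-\<bar>e\<bar>) \<bar>e\<bar> b z) * (1 + norm z) ^ k \<le> C * exp (2 * pi * \<bar>e\<bar> * \<bar>Im z\<bar>)"
    using interval_ft_bump_decay[OF b] by auto
  from this[of "of_real _"] show "\<exists>C. \<forall>x. norm (fourier b x) * (1 + \<bar>x\<bar>) ^ k \<le> C"
    unfolding fourier_bump_eq_interval_ft[OF b] by auto
qed

lemma schwartz_fourier_bump: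
  assumes "b \<in> bump e"
  shows "schwartz (fourier b)"
  unfolding schwartz_iff_smooth_in
proof (rule smooth_in_coinduct)
  show "fourier b \<in> fourier ` bump e" using assms by blast
  show "fourier ` bump e \<subseteq> {f. rapidly_decreasing f}" using rapidly_decreasing_fourier_bump by blast
  fix g assume "g \<in> fourier ` bump e"
  then obtain b where g: "g = fourier b" and b: "b \<in> bump e" by blast
  define b' where "b' u = - 2 * of_real pi * \<i> * of_real u * b u" for u
  have "(\<lambda>u. b u * (- 2 * of_real pi * \<i> * of_real u)) \<in> bump e"
    by (rule bump_times_holomorphic[OF b, of UNIV]) (auto intro!: holomorphic_intros)
  hence b': "b' \<in> bump e" by (simp add: b'_def[abs_def] mult_ac)
  have "(g has_vector_derivative fourier b' x) (at x)" for x
    unfolding g fourier_bump_eq_interval_ft[OF b'] fourier_bump_eq_interval_ft[OF b, abs_def] b'_def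
    by (intro has_vector_derivative_real_field interval_ft_has_field_derivative bump_continuous_on[OF b])
  thus "\<exists>g'\<in>fourier ` bump e. \<forall>x. (g has_vector_derivative g' x) (at x)"
    using b' by blast
qed

lemma schwartz_bump:
  assumes "b \<in> bump e"
  shows "schwartz b"
  unfolding schwartz_iff_smooth_in
proof (rule smooth_in_coinduct[OF assms])
  show "bump e \<subseteq> {f. rapidly_decreasing f}"
  proof clarify
    fix b assume b: "b \<in> bump e"
    obtain M where "M \<ge> 0" and b_le: "\<And>x. norm (b x) \<le> M" using bump_bounded[OF b] by blast
    have "norm (b x) * (1 + \<bar>x\<bar>) ^ k \<le> M * (1 + \<bar>e\<bar>) ^ k" for x k
    proof (cases "e \<le> \<bar>x\<bar>")
      case True
      thus ?thesis using bump_eq_0[OF b] \<open>M \<ge> 0\<close> by simp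
    next
      case False
      thus ?thesis using \<open>M \<ge> 0\<close> b_le by (intro mult_mono power_mono) auto
    qed
    thus "rapidly_decreasing b" unfolding rapidly_decreasing_def by blast
  qed
  show "\<exists>g'\<in>bump e. \<forall>x. (g has_vector_derivative g' x) (at x)" if "g \<in> bump e" for g
    by (rule bump_derivative[OF that], rule bexI) auto
qed

lemma fourier_fourier_bump:
  assumes b: "b \<in> bump e"
  shows "fourier (fourier b) t = b (- t)"
proof -
  have integrable: "integrable lborel (fourier b)"
    by (rule integrable_schwartz[OF schwartz_fourier_bump[OF b]])
  obtain M where "\<And>x. norm (b x) \<le> M" using bump_bounded[OF b] by blast
  hence "(LINT s|lborel. exp2pi (of_real (- t * s)) * fourier b s) = b (- t)"
    by (intro fourier_inversion integrable integrable_schwartz[OF schwartz_bump[OF b]] bump_continuous_on[OF b])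
  thus ?thesis unfolding fourier_eq_lborel[OF integrable] by simp
qed

text \<open>
  Dilates of a band-limited function with nonzero integral form an approximate identity.
\<close>

lemma poly_growth_eq_0_of_band_limited_pairings:
  assumes g: "g \<in> poly_growth_space"
    and pairing: "\<And>phi T. schwartz phi \<Longrightarrow> (\<And>t. T \<le> \<bar>t\<bar> \<Longrightarrow> fourier phi t = 0)
      \<Longrightarrow> (LINT y|lborel. g y * phi y) = 0"
  shows "g x = 0"
proof -
  obtain b where b: "b \<in> bump 1" and "b 0 \<noteq> 0" using bump_exists[of 1] by auto
  define k where "k = fourier b"
  have k: "schwartz k" unfolding k_def by (rule schwartz_fourier_bump[OF b])
  have fourier_k: "fourier k t = b (- t)" for t unfolding k_def by (rule fourier_fourier_bump[OF b])
  have "(LINT v|lborel. g (x + v / real (Suc n)) * k v) = 0" for n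
  proof -
    define \<mu> where "\<mu> = real (Suc n)"
    have "\<mu> > 0" by (simp add: \<mu>_def)
    have "fourier (\<lambda>y. k (\<mu> * y + - \<mu> * x)) t = 0" if "\<mu> \<le> \<bar>t\<bar>" for t
    proof -
      have "1 \<le> \<bar>- (t / \<mu>)\<bar>" using that \<open>\<mu> > 0\<close> by simp
      hence "fourier k (t / \<mu>) = 0" unfolding fourier_k by (rule bump_eq_0[OF b])
      thus ?thesis using \<open>\<mu> > 0\<close> by (subst fourier_affine) (auto intro: integrable_schwartz k)
    qed
    hence "(LINT y|lborel. g y * k (\<mu> * y + - \<mu> * x)) = 0"
      using \<open>\<mu> > 0\<close> by (intro pairing schwartz_affine k) auto
    moreover have "(LINT y|lborel. g y * k (\<mu> * y + - \<mu> * x))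
        = (1 / \<mu>) *\<^sub>R (LINT v|lborel. g (x + 1 / \<mu> * v) * k (\<mu> * (x + 1 / \<mu> * v) + - \<mu> * x))"
      using \<open>\<mu> > 0\<close> by (subst lborel_integral_real_affine[of "1 / \<mu>" _ x]) auto
    moreover have "\<mu> * (x + 1 / \<mu> * v) + - \<mu> * x = v" for v using \<open>\<mu> > 0\<close> by (simp add: field_simps)
    ultimately show ?thesis using \<open>\<mu> > 0\<close> by (simp add: \<mu>_def)
  qed
  moreover obtain A N where g_le: "\<And>x. norm (g x) \<le> A * (1 + \<bar>x\<bar>) ^ N" using poly_growthE[OF g] by blast
  have "(\<lambda>n. LINT v|lborel. g (x + v / real (Suc n)) * k v) \<longlonglongrightarrow> g x * (LINT v|lborel. k v)"
    using borel_measurable_integrable[OF integrable_schwartz[OF k]]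
    by (intro approximate_identity[OF poly_growth_continuous_on[OF g] g_le] integrable_weighted_schwartz[OF k])
  moreover have "(LINT v|lborel. k v) = b 0"
    using fourier_k[of 0] fourier_eq_lborel[OF integrable_schwartz[OF k], of 0] by simp
  ultimately have "(\<lambda>n::nat. 0) \<longlonglongrightarrow> g x * b 0" by simp
  thus ?thesis using \<open>b 0 \<noteq> 0\<close> by (simp add: LIMSEQ_const_iff)
qed

section \<open>Convolution with discrete measures\<close>

lemma has_vector_derivative_suminf:
  fixes f :: "nat \<Rightarrow> real \<Rightarrow> 'a :: banach"
  assumes f: "\<And>n x. (f n has_vector_derivative f' n x) (at x)" "\<And>x. summable (\<lambda>n. f n x)"
    and f': "\<And>n x. norm (f' n x) \<le> M n" "summable M"
  shows "((\<lambda>x. \<Sum>n. f n x) has_vector_derivative (\<Sum>n. f' n x)) (at x)"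
proof -
  define g' where "g' x = (\<Sum>n. f' n x)" for x
  have limit: "uniform_limit UNIV (\<lambda>n x. \<Sum>i<n. f' i x) g' sequentially"
    unfolding g'_def[abs_def] by (rule Weierstrass_m_test[OF f'])
  have "\<exists>g. \<forall>x\<in>UNIV. (\<lambda>n. f n x) sums (g x) \<and> (g has_derivative (\<lambda>h. h *\<^sub>R g' x)) (at x within UNIV)"
  proof (rule has_derivative_series[where f' = "\<lambda>n x h. h *\<^sub>R f' n x"])
    fix e :: real assume "e > 0"
    hence "\<forall>\<^sub>F n in sequentially. \<forall>x\<in>UNIV. dist (\<Sum>i<n. f' i x) (g' x) < e"
      using limit unfolding uniform_limit_iff by blast
    thus "\<forall>\<^sub>F n in sequentially. \<forall>x\<in>UNIV. \<forall>h. norm ((\<Sum>i<n. h *\<^sub>R f' i x) - h *\<^sub>R g' x) \<le> e * norm h"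
    proof eventually_elim
      case (elim n)
      have "norm ((\<Sum>i<n. h *\<^sub>R f' i x) - h *\<^sub>R g' x) = \<bar>h\<bar> * dist (\<Sum>i<n. f' i x) (g' x)" for x h
        by (simp add: dist_norm flip: scaleR_sum_right scaleR_diff_right)
      thus ?case using elim by (auto simp: less_imp_le mult.commute[of e] intro!: mult_left_mono)
    qed
  qed (use f in \<open>auto simp: has_vector_derivative_def summable_sums\<close>)
  then obtain g where g: "\<And>x. (\<lambda>n. f n x) sums (g x)" "\<And>x. (g has_derivative (\<lambda>h. h *\<^sub>R g' x)) (at x)" by auto
  have "g = (\<lambda>x. \<Sum>n. f n x)" using g(1) by (auto simp: sums_iff)
  thus ?thesis using g(2)[of x] unfolding has_vector_derivative_def g'_def by simp
qed

lemma sums_lborel_integral_dominated: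
  fixes g :: "nat \<Rightarrow> real \<Rightarrow> complex"
  assumes g: "\<And>j. g j \<in> borel_measurable lborel" "\<And>j x. norm (g j x) \<le> M j * w x"
    and M: "summable M" and w: "integrable lborel w"
  shows "(\<lambda>j. LINT x|lborel. g j x) sums (LINT x|lborel. (\<Sum>j. g j x))"
    and "summable (\<lambda>j. norm (LINT x|lborel. g j x))"
proof -
  have integrable: "integrable lborel (g j)" for j
    by (rule Bochner_Integration.integrable_bound[OF integrable_mult_right[OF w, of "M j"] g(1)])
       (use g(2)[of j] in \<open>auto intro!: AE_I2 order_trans[OF _ abs_ge_self]\<close>)
  have norm_le: "(LINT x|lborel. norm (g j x)) \<le> M j * (LINT x|lborel. w x)" for j
    unfolding integral_mult_right_zero[symmetric]
    by (intro integral_mono integrable_norm integrable integrable_mult_right w g)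
  have norms: "summable (\<lambda>j. LINT x|lborel. norm (g j x))"
    by (rule summable_comparison_test'[OF summable_mult2[OF M, of "LINT x|lborel. w x"]])
       (use norm_le in \<open>simp add: abs_of_nonneg integral_nonneg_AE\<close>)
  show "(\<lambda>j. LINT x|lborel. g j x) sums (LINT x|lborel. (\<Sum>j. g j x))"
    by (rule sums_integral[OF integrable _ norms])
       (use g(2) in \<open>auto intro!: AE_I2 summable_comparison_test'[OF summable_mult2[OF M]]\<close>)
  show "summable (\<lambda>j. norm (LINT x|lborel. g j x))"
    by (rule summable_comparison_test'[OF norms]) (simp add: integral_norm_bound)
qed

definition shift_series :: "(nat \<Rightarrow> complex) \<Rightarrow> (nat \<Rightarrow> real) \<Rightarrow> (real \<Rightarrow> complex) \<Rightarrow> real \<Rightarrow> complex" where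
  "shift_series c r f x = (\<Sum>j. c j * f (x + r j))"

definition symbol :: "(nat \<Rightarrow> complex) \<Rightarrow> (nat \<Rightarrow> real) \<Rightarrow> real \<Rightarrow> complex" where
  "symbol c r t = (\<Sum>j. c j * exp2pi (of_real (r j * t)))"

locale rapid_coefficients =
  fixes c :: "nat \<Rightarrow> complex" and r :: "nat \<Rightarrow> real"
  assumes summable_weighted: "summable (\<lambda>j. norm (c j) * (1 + \<bar>r j\<bar>) ^ k)"
begin

lemma rapid_coefficients_uminus: "rapid_coefficients c (\<lambda>j. - r j)"
  using summable_weighted by unfold_locales simp

lemma norm_mult_shift_le:
  assumes "f \<in> poly_growth_space"
  obtains M N where "summable M" "\<And>j. M j \<ge> 0" "\<And>j x. norm (c j * f (x + r j)) \<le> M j * (1 + \<bar>x\<bar>) ^ N"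
proof -
  obtain A N where "A \<ge> 0" and f_le: "\<And>x. norm (f x) \<le> A * (1 + \<bar>x\<bar>) ^ N"
    using poly_growthE[OF assms] by blast
  have "norm (c j * f (x + r j)) \<le> A * (norm (c j) * (1 + \<bar>r j\<bar>) ^ N) * (1 + \<bar>x\<bar>) ^ N" for j x
  proof -
    have "norm (f (x + r j)) \<le> A * ((1 + \<bar>x\<bar>) * (1 + \<bar>r j\<bar>)) ^ N"
      using \<open>A \<ge> 0\<close> one_plus_norm_add_le[of x "r j"]
      by (intro order_trans[OF f_le] mult_left_mono power_mono) auto
    from mult_left_mono[OF this norm_ge_zero[of "c j"]] show ?thesis
      by (simp add: norm_mult power_mult_distrib mult_ac)
  qed
  thus thesis
    using \<open>A \<ge> 0\<close> by (intro that[of "\<lambda>j. A * (norm (c j) * (1 + \<bar>r j\<bar>) ^ N)"] summable_mult summable_weighted) auto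
qed

lemma summable_mult_shift:
  assumes "f \<in> poly_growth_space"
  shows "summable (\<lambda>j. c j * f (x + r j))"
proof -
  obtain M N where "summable M" and term_le: "\<And>j x. norm (c j * f (x + r j)) \<le> M j * (1 + \<bar>x\<bar>) ^ N"
    using norm_mult_shift_le[OF assms] by metis
  show ?thesis
    by (rule summable_comparison_test'[OF summable_mult2[OF \<open>summable M\<close>] term_le])
qed

lemma shift_series_in_poly_growth_space:
  assumes f: "f \<in> poly_growth_space"
  shows "shift_series c r f \<in> poly_growth_space"
proof -
  obtain M N where "summable M" "\<And>j. M j \<ge> 0"
    and term_le: "\<And>j x. norm (c j * f (x + r j)) \<le> M j * (1 + \<bar>x\<bar>) ^ N"
    using norm_mult_shift_le[OF f] by metis
  have "isCont (shift_series c r f) x" for x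
  proof -
    let ?S = "{x - 1<..<x + 1}"
    have "norm (c j * f (y + r j)) \<le> M j * (2 + \<bar>x\<bar>) ^ N" if "y \<in> ?S" for j y
      using that \<open>M j \<ge> 0\<close> by (intro order_trans[OF term_le] mult_left_mono power_mono) auto
    hence "uniform_limit ?S (\<lambda>n y. \<Sum>j<n. c j * f (y + r j)) (\<lambda>y. \<Sum>j. c j * f (y + r j)) sequentially"
      by (rule Weierstrass_m_test[OF _ summable_mult2[OF \<open>summable M\<close>]])
    hence "continuous_on ?S (shift_series c r f)"
      unfolding shift_series_def[abs_def]
      by (rule uniform_limit_theorem[rotated])
         (auto intro!: always_eventually continuous_intros continuous_on_compose2[OF poly_growth_continuous_on[OF f]])
    thus ?thesis by (simp add: continuous_on_eq_continuous_at)
  qed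
  moreover have "norm (shift_series c r f x) \<le> (\<Sum>j. M j) * (1 + \<bar>x\<bar>) ^ N" for x
    unfolding shift_series_def suminf_mult2[OF \<open>summable M\<close>]
    by (intro norm_suminf_le term_le summable_mult2 \<open>summable M\<close>)
  ultimately show ?thesis
    unfolding poly_growth_space_def by (blast intro: continuous_at_imp_continuous_on)
qed

lemma rapidly_decreasing_shift_series:
  assumes phi: "schwartz phi"
  shows "rapidly_decreasing (shift_series c r phi)"
  unfolding rapidly_decreasing_def
proof
  fix k :: nat
  obtain C where "C \<ge> 0" and phi_le: "\<And>x r. norm (phi (x + r)) * (1 + \<bar>x\<bar>) ^ k \<le> C * (1 + \<bar>r\<bar>) ^ k"
    using rapidly_decreasing_shift_bound[OF schwartz_imp_rapidly_decreasing[OF phi]] by metis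
  have "norm (shift_series c r phi x) * (1 + \<bar>x\<bar>) ^ k \<le> (\<Sum>j. C * (norm (c j) * (1 + \<bar>r j\<bar>) ^ k))" for x
  proof -
    have "norm (shift_series c r phi x) * (1 + \<bar>x\<bar>) ^ k = norm (\<Sum>j. c j * phi (x + r j) * of_real ((1 + \<bar>x\<bar>) ^ k))"
      unfolding shift_series_def
      by (subst suminf_mult2[OF summable_mult_shift[OF schwartz_in_poly_growth_space[OF phi]], symmetric])
         (simp add: norm_mult del: of_real_power)
    also have "\<dots> \<le> (\<Sum>j. C * (norm (c j) * (1 + \<bar>r j\<bar>) ^ k))"
    proof (rule norm_suminf_le[OF _ summable_mult[OF summable_weighted]])
      fix j
      show "norm (c j * phi (x + r j) * of_real ((1 + \<bar>x\<bar>) ^ k)) \<le> C * (norm (c j) * (1 + \<bar>r j\<bar>) ^ k)"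
        using mult_left_mono[OF phi_le[of x "r j"] norm_ge_zero[of "c j"]]
        by (simp add: norm_mult mult_ac del: of_real_power)
    qed
    finally show ?thesis .
  qed
  thus "\<exists>C. \<forall>x. norm (shift_series c r phi x) * (1 + \<bar>x\<bar>) ^ k \<le> C" by blast
qed

lemma schwartz_shift_series:
  assumes "schwartz phi"
  shows "schwartz (shift_series c r phi)"
  unfolding schwartz_iff_smooth_in
proof (rule smooth_in_coinduct)
  let ?A = "shift_series c r ` {phi. schwartz phi}"
  show "shift_series c r phi \<in> ?A" using assms by blast
  show "?A \<subseteq> {f. rapidly_decreasing f}" using rapidly_decreasing_shift_series by blast
  fix g assume "g \<in> ?A"
  then obtain phi where g: "g = shift_series c r phi" and phi: "schwartz phi" by blast
  obtain phi' where phi': "schwartz phi'" "\<And>x. (phi has_vector_derivative phi' x) (at x)"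
    using schwartz_derivative[OF phi] by blast
  obtain B where phi'_le: "\<And>x. norm (phi' x) \<le> B" using schwartz_bounded[OF phi'(1)] by blast
  have "(g has_vector_derivative shift_series c r phi' x) (at x)" for x
    unfolding g shift_series_def
  proof (rule has_vector_derivative_suminf)
    fix j x
    have "((\<lambda>x. x + r j) has_vector_derivative 1) (at x)"
      by (auto intro!: derivative_eq_intros)
    from vector_diff_chain_at[OF this phi'(2)]
    show "((\<lambda>x. c j * phi (x + r j)) has_vector_derivative c j * phi' (x + r j)) (at x)"
      by (intro has_vector_derivative_mult_right) (simp add: o_def)
    show "summable (\<lambda>j. c j * phi (x + r j))"
      by (rule summable_mult_shift[OF schwartz_in_poly_growth_space[OF phi]])
    show "norm (c j * phi' (x + r j)) \<le> norm (c j) * (1 + \<bar>r j\<bar>) ^ 0 * B"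
      using phi'_le by (simp add: norm_mult mult_left_mono)
  qed (intro summable_mult2 summable_weighted)
  thus "\<exists>g'\<in>?A. \<forall>x. (g has_vector_derivative g' x) (at x)"
    using phi'(1) by (intro bexI[of _ "shift_series c r phi'"]) auto
qed

lemma integral_mult_shift_series:
  assumes f: "f \<in> poly_growth_space" and phi: "schwartz phi"
  shows "(\<lambda>j. c j * (LINT x|lborel. f x * phi (x + r j))) sums (LINT x|lborel. f x * shift_series c r phi x)"
    and "summable (\<lambda>j. norm (c j * (LINT x|lborel. f x * phi (x + r j))))"
proof -
  obtain C m where "C \<ge> 0"
    and product_le: "\<And>x r. norm (f x * phi (x + r)) \<le> C * (1 + \<bar>r\<bar>) ^ m * (1 / (1 + \<bar>x\<bar>)\<^sup>2)"
    using poly_growth_times_shift_bound[OF f schwartz_imp_rapidly_decreasing[OF phi]] by metis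
  define g where "g j x = c j * (f x * phi (x + r j))" for j x
  have g_meas: "g j \<in> borel_measurable lborel" for j
  proof -
    have "continuous_on UNIV (g j)"
      unfolding g_def[abs_def]
      by (intro continuous_intros poly_growth_continuous_on[OF f]
          continuous_on_compose2[OF schwartz_imp_continuous_on[OF phi, of UNIV]]) auto
    thus ?thesis by (simp add: borel_measurable_continuous_onI)
  qed
  have g_le: "norm (g j x) \<le> C * (norm (c j) * (1 + \<bar>r j\<bar>) ^ m) * (1 / (1 + \<bar>x\<bar>)\<^sup>2)" for j x
    using mult_left_mono[OF product_le[of x "r j"] norm_ge_zero[of "c j"]] by (simp add: g_def norm_mult mult_ac)
  note sums_and_summable = sums_lborel_integral_dominated[OF g_meas g_le
      summable_mult[OF summable_weighted] integrable_inverse_square]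
  have "(\<Sum>j. g j x) = f x * shift_series c r phi x" for x
    using suminf_mult[OF summable_mult_shift[OF schwartz_in_poly_growth_space[OF phi]], of "f x" x]
    by (simp add: g_def shift_series_def mult_ac)
  thus "(\<lambda>j. c j * (LINT x|lborel. f x * phi (x + r j))) sums (LINT x|lborel. f x * shift_series c r phi x)"
    "summable (\<lambda>j. norm (c j * (LINT x|lborel. f x * phi (x + r j))))"
    using sums_and_summable by (simp_all add: g_def)
qed

lemma integral_shift_series_mult:
  assumes f: "f \<in> poly_growth_space" and phi: "schwartz phi"
  shows "(LINT x|lborel. shift_series c (\<lambda>j. - r j) f x * phi x) = (LINT x|lborel. f x * shift_series c r phi x)"
proof -
  interpret reflected: rapid_coefficients c "\<lambda>j. - r j" by (rule rapid_coefficients_uminus)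
  obtain M N where "summable M" and term_le: "\<And>j x. norm (c j * f (x + - r j)) \<le> M j * (1 + \<bar>x\<bar>) ^ N"
    using reflected.norm_mult_shift_le[OF f] by metis
  define g where "g j x = c j * f (x + - r j) * phi x" for j x
  have g_meas: "g j \<in> borel_measurable lborel" for j
  proof -
    have "continuous_on UNIV (g j)"
      unfolding g_def[abs_def]
      by (intro continuous_intros schwartz_imp_continuous_on[OF phi]
          continuous_on_compose2[OF poly_growth_continuous_on[OF f]]) auto
    thus ?thesis by (simp add: borel_measurable_continuous_onI)
  qed
  have g_le: "norm (g j x) \<le> M j * ((1 + \<bar>x\<bar>) ^ N * norm (phi x))" for j x
    using mult_right_mono[OF term_le norm_ge_zero[of "phi x"]] by (simp add: g_def norm_mult mult.assoc)
  have "(\<lambda>j. LINT x|lborel. g j x) sums (LINT x|lborel. (\<Sum>j. g j x))"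
    by (rule sums_lborel_integral_dominated[OF g_meas g_le \<open>summable M\<close> integrable_weighted_schwartz[OF phi]])
  moreover have "(\<Sum>j. g j x) = shift_series c (\<lambda>j. - r j) f x * phi x" for x
    unfolding g_def shift_series_def by (rule suminf_mult2[OF reflected.summable_mult_shift[OF f], symmetric])
  moreover have "(LINT x|lborel. g j x) = c j * (LINT x|lborel. f x * phi (x + r j))" for j
    using lborel_integral_real_affine[of 1 "g j" "r j"] by (simp add: g_def mult.assoc add.commute)
  ultimately show ?thesis
    using integral_mult_shift_series(1)[OF f phi] sums_unique2 by auto
qed

lemma fourier_shift_series:
  assumes phi: "schwartz phi"
  shows "fourier (shift_series c r phi) t = symbol c r t * fourier phi t"
proof -
  have translate: "(LINT x|lborel. exp2pi (of_real (- t * x)) * phi (x + r j))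
      = exp2pi (of_real (r j * t)) * fourier phi t" for j
    using fourier_affine[OF integrable_schwartz[OF phi], of 1 "r j" t]
      fourier_eq_lborel[OF integrable_schwartz[OF schwartz_affine[OF phi, of 1 "r j"]], of t]
    by (simp add: mult.commute)
  have "(\<lambda>j. c j * exp2pi (of_real (r j * t)) * fourier phi t) sums fourier (shift_series c r phi) t"
    using integral_mult_shift_series(1)[OF exp2pi_in_poly_growth_space phi, of "- t"]
    unfolding translate fourier_eq_lborel[OF integrable_schwartz[OF schwartz_shift_series[OF phi]]]
    by (simp add: mult.assoc)
  moreover have "summable (\<lambda>j. c j * exp2pi (of_real (r j * t)))"
    using summable_mult_shift[OF exp2pi_in_poly_growth_space[of t], of 0] by (simp add: mult.commute)
  ultimately show ?thesis
    by (simp add: symbol_def suminf_mult2 sums_iff)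
qed

end

section \<open>Sampling on a lattice\<close>

text \<open>
  Sums over \<open>l \<int>\<close> are written as series over \<open>nat\<close> along the enumeration \<open>int_decode\<close>, which runs through
  \<open>0, -1, 1, -2, \<dots>\<close>.
\<close>

definition lattice_point :: "real \<Rightarrow> nat \<Rightarrow> real" where
  "lattice_point l j = l * of_int (int_decode j)"

lemma summable_lattice_inverse_square:
  assumes "l > 0"
  shows "summable (\<lambda>j. 1 / (1 + \<bar>lattice_point l j\<bar>)\<^sup>2)"
proof (rule summable_comparison_test')
  define M where "M = 2 * (1 + 1 / l)"
  show "summable (\<lambda>j. M\<^sup>2 * inverse ((real (Suc j))\<^sup>2))"
    using inverse_power_summable[of 2, where 'a = real] by (intro summable_mult) (subst summable_Suc_iff, simp)
  fix j
  have "real (Suc j) \<le> 2 * (1 + \<bar>real_of_int (int_decode j)\<bar>)"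
    by (cases "even j") (auto simp: int_decode_def sum_decode_def elim!: evenE oddE)
  also have "\<dots> \<le> M * (1 + \<bar>lattice_point l j\<bar>)"
    using assms by (simp add: M_def lattice_point_def abs_mult field_simps)
  finally have "(real (Suc j))\<^sup>2 \<le> (M * (1 + \<bar>lattice_point l j\<bar>))\<^sup>2" by (rule power_mono) simp
  hence "(real (Suc j))\<^sup>2 \<le> M\<^sup>2 * (1 + \<bar>lattice_point l j\<bar>)\<^sup>2" by (simp only: power_mult_distrib)
  thus "norm (1 / (1 + \<bar>lattice_point l j\<bar>)\<^sup>2) \<le> M\<^sup>2 * inverse ((real (Suc j))\<^sup>2)"
    by (simp add: field_simps del: of_nat_Suc)
qed

lemma lattice_point_0 [simp]: "lattice_point l 0 = 0"
  by (simp add: lattice_point_def int_decode_def sum_decode_def)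

lemma rapid_coefficients_lattice_samples:
  assumes phi: "rapidly_decreasing phi" and "l > 0" and u: "\<And>j. norm (u j) \<le> 1"
  shows "rapid_coefficients (\<lambda>j. phi (lattice_point l j) * u j) (lattice_point l)"
proof
  fix k
  obtain C where phi_le: "\<And>x. norm (phi x) * (1 + \<bar>x\<bar>) ^ (k + 2) \<le> C"
    using rapidly_decreasingE[OF phi, where k = "k + 2"] by blast
  show "summable (\<lambda>j. norm (phi (lattice_point l j) * u j) * (1 + \<bar>lattice_point l j\<bar>) ^ k)"
  proof (rule summable_comparison_test'[OF summable_mult[OF summable_lattice_inverse_square[OF \<open>l > 0\<close>]]])
    fix j
    let ?x = "lattice_point l j"
    have "norm (phi ?x * u j) * (1 + \<bar>?x\<bar>) ^ k * (1 + \<bar>?x\<bar>)\<^sup>2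
        \<le> norm (phi ?x) * (1 + \<bar>?x\<bar>) ^ k * (1 + \<bar>?x\<bar>)\<^sup>2"
      using u[of j] unfolding norm_mult by (intro mult_right_mono mult_left_le) auto
    also have "\<dots> \<le> C" using phi_le[of ?x] by (simp add: power2_eq_square mult_ac)
    finally show "norm (norm (phi ?x * u j) * (1 + \<bar>?x\<bar>) ^ k) \<le> C * (1 / (1 + \<bar>?x\<bar>)\<^sup>2)"
      by (simp add: pos_le_divide_eq)
  qed
qed

lemma rapid_coefficients_fourier_bump_samples:
  assumes "b \<in> bump e" "l > 0"
  shows "rapid_coefficients (\<lambda>j. fourier b (lattice_point l j)) (lattice_point l)"
  using rapid_coefficients_lattice_samples[OF rapidly_decreasing_fourier_bump[OF assms(1)] assms(2), of "\<lambda>_. 1"]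
  by simp

lemma sum_int_decode_telescope:
  fixes a :: "int \<Rightarrow> 'a :: ab_group_add"
  shows "(\<Sum>j<2 * N. a (int_decode j + 1) - a (int_decode j)) = a (int N) - a (- int N)"
proof (induction N)
  case (Suc N)
  have decode: "int_decode (2 * N) = int N" "int_decode (Suc (2 * N)) = - int N - 1"
    by (simp_all add: int_decode_def sum_decode_def)
  have "2 * Suc N = Suc (Suc (2 * N))" "int (Suc N) = int N + 1" "- (int N + 1) = - int N - 1"
    "- int N - 1 + 1 = - int N" by auto
  thus ?case by (simp only: sum.lessThan_Suc Suc.IH decode) simp
qed simp

lemma exp2pi_neq_1_off_lattice:
  assumes "l > 0" and far: "\<And>k::int. \<bar>t - of_int k / l\<bar> > e" and "\<bar>u\<bar> \<le> e"
  shows "exp2pi (of_real (l * (t - u))) \<noteq> 1"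
proof
  assume "exp2pi (of_real (l * (t - u))) = 1"
  hence "l * (t - u) \<in> \<int>" by (simp only: exp2pi_eq_1_iff of_real_in_Ints_iff)
  then obtain k :: int where "l * (t - u) = of_int k" by (elim Ints_cases)
  hence "t - of_int k / l = u" using \<open>l > 0\<close> by (simp add: field_simps)
  thus False using far[of k] \<open>\<bar>u\<bar> \<le> e\<close> by simp
qed

text \<open>
  The vanishing half of Poisson summation: dividing the bump by \<open>exp2pi (l (t - u)) - 1\<close> makes the series telescope.
\<close>

lemma fourier_bump_eq_difference:
  assumes b: "b \<in> bump e" and "l > 0" and far: "\<And>k::int. \<bar>t - of_int k / l\<bar> > e"
  obtains g where "g \<in> bump e"
    "\<And>x. fourier b x = exp2pi (of_real (l * t)) * fourier g (x + l) - fourier g x"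
proof -
  define q where "q w = exp2pi (of_real l * (of_real t - w)) - 1" for w
  define g where "g u = b u * inverse (q (of_real u))" for u
  have q_nz: "q (of_real u) \<noteq> 0" if "u \<in> {-e..e}" for u
    using exp2pi_neq_1_off_lattice[OF \<open>l > 0\<close> far, of u] that by (auto simp: q_def abs_le_iff)
  have "open (q -` (- {0}))"
    unfolding q_def by (intro open_vimage continuous_intros)
  hence g: "g \<in> bump e"
    unfolding g_def[abs_def] using q_nz
    by (intro bump_times_holomorphic[OF b]) (auto simp: q_def intro!: holomorphic_intros)
  have "fourier b x = exp2pi (of_real (l * t)) * fourier g (x + l) - fourier g x" for x
  proof -
    have integrand: "b u * exp2pi (- (of_real x * of_real u))
        = exp2pi (of_real (l * t)) * (g u * exp2pi (- (of_real (x + l) * of_real u)))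
          - g u * exp2pi (- (of_real x * of_real u))"
      if u: "u \<in> {-e..e}" for u
    proof -
      have "exp2pi (of_real (l * t)) * exp2pi (- (of_real (x + l) * of_real u))
          = (q (of_real u) + 1) * exp2pi (- (of_real x * of_real u))"
        by (simp add: q_def exp2pi_add[symmetric] algebra_simps)
      thus ?thesis using q_nz[OF u] by (simp add: g_def field_simps)
    qed
    have "interval_ft (-e) e b (of_real x)
        = integral {-e..e} (\<lambda>u. exp2pi (of_real (l * t)) * (g u * exp2pi (- (of_real (x + l) * of_real u)))
          - g u * exp2pi (- (of_real x * of_real u)))"
      unfolding interval_ft_def by (rule Henstock_Kurzweil_Integration.integral_cong) (rule integrand)
    also have "\<dots> = exp2pi (of_real (l * t)) * interval_ft (-e) e g (of_real (x + l)) - interval_ft (-e) e g (of_real x)"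
      unfolding interval_ft_def integral_mult_right[symmetric] using bump_continuous_on[OF g]
      by (intro Henstock_Kurzweil_Integration.integral_diff integrable_on_mult_right interval_ft_integrable_on)
    finally show ?thesis unfolding fourier_bump_eq_interval_ft[OF b] fourier_bump_eq_interval_ft[OF g] .
  qed
  thus thesis using that g by blast
qed

lemma modulated_lattice_samples_tendsto_0:
  fixes n :: "nat \<Rightarrow> int" and y :: "nat \<Rightarrow> real"
  assumes phi: "rapidly_decreasing phi" and "l > 0" and n: "\<And>N. \<bar>n N\<bar> = int N"
  shows "(\<lambda>N. phi (l * of_int (n N)) * exp2pi (of_real (y N))) \<longlonglongrightarrow> 0"
proof -
  obtain C where phi_le: "\<And>x. norm (phi x) * (1 + \<bar>x\<bar>) ^ 1 \<le> C"
    using rapidly_decreasingE[OF phi, where k = 1] by blast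
  have norm_le: "norm (phi (l * of_int (n N)) * exp2pi (of_real (y N))) \<le> C / (1 + l * real N)" for N
  proof -
    have "\<bar>l * of_int (n N)\<bar> = l * real N"
      using n[of N] \<open>l > 0\<close> by (simp add: abs_mult flip: of_int_abs)
    thus ?thesis using phi_le[of "l * of_int (n N)"] \<open>l > 0\<close>
      unfolding norm_mult norm_exp2pi_of_real by (simp add: pos_le_divide_eq add_pos_nonneg)
  qed
  have "(\<lambda>N. C / (1 + l * real N)) \<longlonglongrightarrow> 0" using \<open>l > 0\<close> by real_asymp
  thus ?thesis by (rule Lim_null_comparison[OF always_eventually, rotated]) (intro allI norm_le)
qed

lemma symbol_fourier_bump_samples_eq_0:
  assumes b: "b \<in> bump e" and "l > 0" and far: "\<And>k::int. \<bar>t - of_int k / l\<bar> > e"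
  shows "symbol (\<lambda>j. fourier b (lattice_point l j)) (lattice_point l) t = 0"
proof -
  obtain g where g: "g \<in> bump e"
    and difference: "\<And>x. fourier b x = exp2pi (of_real (l * t)) * fourier g (x + l) - fourier g x"
    using fourier_bump_eq_difference[OF b \<open>l > 0\<close> far] by metis
  define G where "G n = fourier g (l * of_int n) * exp2pi (of_real (l * of_int n * t))" for n
  define a where "a j = fourier b (lattice_point l j) * exp2pi (of_real (lattice_point l j * t))" for j
  have a_eq: "a j = G (int_decode j + 1) - G (int_decode j)" for j
  proof -
    let ?x = "lattice_point l j"
    have "a j = fourier g (?x + l) * (exp2pi (of_real (?x * t)) * exp2pi (of_real (l * t)))
        - fourier g ?x * exp2pi (of_real (?x * t))"
      unfolding a_def difference by (simp add: algebra_simps)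
    thus ?thesis by (simp add: G_def lattice_point_def algebra_simps flip: exp2pi_add)
  qed
  have "(\<lambda>N. G (int N)) \<longlonglongrightarrow> 0" "(\<lambda>N. G (- int N)) \<longlonglongrightarrow> 0"
    unfolding G_def
    by (rule modulated_lattice_samples_tendsto_0[OF rapidly_decreasing_fourier_bump[OF g] \<open>l > 0\<close>], simp)+
  from tendsto_diff[OF this] have "(\<lambda>N. G (int N) - G (- int N)) \<longlonglongrightarrow> 0" by simp
  moreover have "(\<Sum>j<2 * N. a j) = G (int N) - G (- int N)" for N
    unfolding a_eq by (rule sum_int_decode_telescope)
  moreover have "summable a"
    using rapid_coefficients.summable_mult_shift[OF rapid_coefficients_fourier_bump_samples[OF b \<open>l > 0\<close>]
        exp2pi_in_poly_growth_space[of t], of 0]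
    by (simp add: a_def[abs_def] mult.commute)
  hence "(\<lambda>N. \<Sum>j<2 * N. a j) \<longlonglongrightarrow> (\<Sum>j. a j)"
    by (intro filterlim_compose[OF summable_LIMSEQ] filterlim_subseq) (auto simp: strict_mono_def)
  ultimately show ?thesis unfolding symbol_def a_def[symmetric] using LIMSEQ_unique by auto
qed

section \<open>Localization at the spectrum\<close>

lemma sums_interval_integral:
  fixes f :: "nat \<Rightarrow> real \<Rightarrow> 'a :: banach"
  assumes f: "\<And>j. continuous_on {a..b} (f j)" and f_le: "\<And>j x. x \<in> {a..b} \<Longrightarrow> norm (f j x) \<le> M j" "summable M"
  shows "(\<lambda>j. integral {a..b} (f j)) sums integral {a..b} (\<lambda>x. \<Sum>j. f j x)"
proof -
  have limit: "uniform_limit {a..b} (\<lambda>n x. \<Sum>j<n. f j x) (\<lambda>x. \<Sum>j. f j x) sequentially"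
    by (rule Weierstrass_m_test[OF f_le])
  obtain I J where partial_sums: "\<And>n. ((\<lambda>x. \<Sum>j<n. f j x) has_integral I n) {a..b}"
    and limit_integral: "((\<lambda>x. \<Sum>j. f j x) has_integral J) {a..b}" "(I \<longlongrightarrow> J) sequentially"
    by (rule uniform_limit_integral[OF limit]) (auto intro!: continuous_intros f)
  have "((\<lambda>x. \<Sum>j<n. f j x) has_integral (\<Sum>j<n. integral {a..b} (f j))) {a..b}" for n
    by (intro has_integral_sum integrable_integral integrable_continuous_interval f) auto
  hence "I = (\<lambda>n. \<Sum>j<n. integral {a..b} (f j))"
    using partial_sums has_integral_unique by blast
  thus ?thesis using limit_integral unfolding sums_def by (simp add: integral_unique)
qed

lemma trigonometric_series_coefficient_eq_0:
  assumes "L > 0" and a: "summable (\<lambda>j. norm (a j))"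
    and zero: "\<And>\<tau>. \<tau> \<in> {-L..L} \<Longrightarrow> (\<Sum>j. a j * exp2pi (of_real (- (lattice_point (1 / (2 * L)) j * \<tau>)))) = 0"
  shows "a k = 0"
proof -
  define r where "r = lattice_point (1 / (2 * L))"
  define g where "g j \<tau> = a j * exp2pi (of_real (- ((r j - r k) * \<tau>)))" for j \<tau>
  have "(\<Sum>j. g j \<tau>) = 0" if \<tau>: "\<tau> \<in> {-L..L}" for \<tau>
  proof -
    have "g j \<tau> = a j * exp2pi (of_real (- (r j * \<tau>))) * exp2pi (of_real (r k * \<tau>))" for j
      by (simp add: g_def mult.assoc algebra_simps flip: exp2pi_add)
    moreover have "summable (\<lambda>j. a j * exp2pi (of_real (- (r j * \<tau>))))"
      by (rule summable_norm_cancel) (use a in \<open>simp add: norm_mult del: of_real_mult of_real_minus\<close>)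
    ultimately show ?thesis using zero[OF \<tau>] by (simp add: r_def flip: suminf_mult2)
  qed
  hence "integral {-L..L} (\<lambda>\<tau>. \<Sum>j. g j \<tau>) = 0"
    by (subst Henstock_Kurzweil_Integration.integral_cong[of _ _ "\<lambda>_. 0"]) auto
  moreover have "(\<lambda>j. integral {-L..L} (g j)) sums integral {-L..L} (\<lambda>\<tau>. \<Sum>j. g j \<tau>)"
  proof (rule sums_interval_integral[OF _ _ a])
    show "continuous_on {-L..L} (g j)" for j unfolding g_def by (intro continuous_intros)
    show "norm (g j \<tau>) \<le> norm (a j)" for j \<tau>
      unfolding g_def norm_mult norm_exp2pi_of_real by simp
  qed
  moreover have "integral {-L..L} (g j) = (if j = k then a k * of_real (2 * L) else 0)" for j
  proof -
    have "complex_of_real (r j - r k) = of_int (int_decode j - int_decode k) / of_real (L - - L)"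
      using \<open>L > 0\<close> by (simp add: r_def lattice_point_def field_simps)
    moreover have "int_decode j - int_decode k = 0 \<longleftrightarrow> j = k"
      by (metis diff_self int_decode_inverse right_minus_eq)
    moreover have "integral {-L..L} (g j) = a j * interval_ft (-L) L (\<lambda>_. 1) (of_real (r j - r k))"
      by (simp add: g_def[abs_def] interval_ft_def)
    ultimately show ?thesis using interval_ft_1_of_int[of "-L" L "int_decode j - int_decode k"] \<open>L > 0\<close> by simp
  qed
  ultimately have "(\<lambda>j. if j = k then a k * of_real (2 * L) else 0) sums 0" by simp
  from sums_unique2[OF sums_single[of k "\<lambda>_. a k * of_real (2 * L)"] this]
  have "a k * of_real (2 * L) = 0" .
  thus ?thesis using \<open>L > 0\<close> by simp
qed

definition window :: "(real \<Rightarrow> complex) \<Rightarrow> real \<Rightarrow> real \<Rightarrow> nat \<Rightarrow> complex" where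
  "window b L \<tau> j
    = fourier b (lattice_point (1 / (2 * L)) j) * exp2pi (of_real (- (lattice_point (1 / (2 * L)) j * \<tau>)))"

lemma rapid_coefficients_window:
  "b \<in> bump e \<Longrightarrow> L > 0 \<Longrightarrow> rapid_coefficients (window b L \<tau>) (lattice_point (1 / (2 * L)))"
  unfolding window_def[abs_def]
  by (rule rapid_coefficients_lattice_samples)
     (simp_all add: rapidly_decreasing_fourier_bump del: of_real_mult of_real_minus)

lemma symbol_window_eq_0:
  assumes "b \<in> bump e" "L > 0" and t: "e < \<bar>t - \<tau>\<bar>" "\<bar>t - \<tau>\<bar> < 2 * L - e"
  shows "symbol (window b L \<tau>) (lattice_point (1 / (2 * L))) t = 0"
proof -
  have "symbol (window b L \<tau>) (lattice_point (1 / (2 * L))) t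
      = symbol (\<lambda>j. fourier b (lattice_point (1 / (2 * L)) j)) (lattice_point (1 / (2 * L))) (t - \<tau>)"
    by (simp add: symbol_def window_def mult.assoc right_diff_distrib flip: exp2pi_add)
  also have "\<dots> = 0"
  proof (rule symbol_fourier_bump_samples_eq_0)
    fix k :: int
    show "e < \<bar>t - \<tau> - of_int k / (1 / (2 * L))\<bar>"
    proof (cases "k = 0")
      case False
      hence "2 * L * 1 \<le> 2 * L * \<bar>real_of_int k\<bar>" using \<open>L > 0\<close> by (intro mult_left_mono) auto
      hence "2 * L \<le> \<bar>of_int k / (1 / (2 * L))\<bar>" using \<open>L > 0\<close> by (simp add: abs_mult mult_ac)
      thus ?thesis using t(2) by linarith
    qed (use t in simp)
  qed (use assms in auto)
  finally show ?thesis .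
qed

lemma windowed_pairing_eq_0:
  assumes f: "f \<in> poly_growth_space" and phi: "schwartz phi" and band: "\<And>t. T \<le> \<bar>t\<bar> \<Longrightarrow> fourier phi t = 0"
    and b: "b \<in> bump e" and L: "T + e \<le> L" "0 < L" and "\<bar>\<tau>\<bar> \<le> L"
    and near: "(\<forall>t\<in>cball \<tau> e. fourier phi t = 0) \<or> (\<exists>S. annihilates S f \<and> S \<inter> cball \<tau> e = {})"
  shows "(LINT x|lborel. f x * shift_series (window b L \<tau>) (lattice_point (1 / (2 * L))) phi x) = 0"
proof -
  interpret rapid_coefficients "window b L \<tau>" "lattice_point (1 / (2 * L))"
    by (rule rapid_coefficients_window) fact+
  define psi where "psi = shift_series (window b L \<tau>) (lattice_point (1 / (2 * L))) phi"
  have psi: "schwartz psi" unfolding psi_def by (rule schwartz_shift_series[OF phi])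
  have far: "fourier psi t = 0" if "t \<in> - cball \<tau> e" for t
  proof (cases "T \<le> \<bar>t\<bar>")
    case True
    thus ?thesis by (simp add: psi_def fourier_shift_series[OF phi] band)
  next
    case False
    hence "\<bar>t - \<tau>\<bar> < 2 * L - e" using L \<open>\<bar>\<tau>\<bar> \<le> L\<close> by linarith
    hence "symbol (window b L \<tau>) (lattice_point (1 / (2 * L))) t = 0"
      using that b L by (intro symbol_window_eq_0) (auto simp: dist_real_def)
    thus ?thesis by (simp add: psi_def fourier_shift_series[OF phi])
  qed
  from near have "integral UNIV (\<lambda>x. f x * psi x) = 0"
  proof
    assume "\<forall>t\<in>cball \<tau> e. fourier phi t = 0"
    hence "fourier psi t = 0" for t
      using far by (cases "t \<in> cball \<tau> e") (auto simp: psi_def fourier_shift_series[OF phi])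
    thus ?thesis using schwartz_eq_0_of_fourier_eq_0[OF psi] by simp
  next
    assume "\<exists>S. annihilates S f \<and> S \<inter> cball \<tau> e = {}"
    then obtain S where "annihilates S f" "S \<subseteq> - cball \<tau> e" by blast
    thus ?thesis
      using psi far unfolding annihilates_def by (metis closed_cball open_Compl)
  qed
  thus ?thesis using integral_poly_growth_times_schwartz[OF f psi] by (simp add: psi_def)
qed

lemma uniform_scale_of_local_annihilation:
  assumes "open U" "spectrum_of f \<subseteq> U" "compact K"
  obtains e where "0 < e" "e \<le> 1"
    "\<And>\<tau>. \<tau> \<in> K \<Longrightarrow> cball \<tau> e \<subseteq> U \<or> (\<exists>S. annihilates S f \<and> S \<inter> cball \<tau> e = {})"
proof -
  define G where "G = insert U {- S | S. closed S \<and> annihilates S f}"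
  have "K \<subseteq> \<Union>G"
    using assms(2) unfolding spectrum_of_def G_def by blast
  moreover have "\<And>V. V \<in> G \<Longrightarrow> open V" using assms(1) by (auto simp: G_def)
  ultimately obtain d where "d > 0" and ball_subset: "\<And>\<tau>. \<tau> \<in> K \<Longrightarrow> \<exists>V\<in>G. ball \<tau> d \<subseteq> V"
    using Heine_Borel_lemma[of K G] assms(3) by metis
  show thesis
  proof (rule that)
    show "0 < min (d / 2) 1" "min (d / 2) 1 \<le> 1" using \<open>d > 0\<close> by auto
    fix \<tau> assume "\<tau> \<in> K"
    then obtain V where V: "V \<in> G" "ball \<tau> d \<subseteq> V" using ball_subset by blast
    moreover have "cball \<tau> (min (d / 2) 1) \<subseteq> ball \<tau> d" using \<open>d > 0\<close> by (auto simp: min_def)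
    ultimately show "cball \<tau> (min (d / 2) 1) \<subseteq> U \<or> (\<exists>S. annihilates S f \<and> S \<inter> cball \<tau> (min (d / 2) 1) = {})"
      unfolding G_def by blast
  qed
qed

text \<open>
  In place of a partition of unity on the Fourier side: multiplying the transform of \<open>phi\<close> by a periodized
  bump around \<open>\<tau>\<close> gives a test function whose pairing with \<open>f\<close> vanishes by local annihilation near \<open>\<tau>\<close>. As
  a function of \<open>\<tau>\<close> this pairing is an absolutely convergent Fourier series with constant term \<open>\<integral> f phi\<close>.
\<close>

theorem integral_eq_0_of_fourier_eq_0_near_spectrum:
  assumes f: "f \<in> poly_growth_space" and phi: "schwartz phi" and band: "\<And>t. T \<le> \<bar>t\<bar> \<Longrightarrow> fourier phi t = 0"
    and U: "open U" "spectrum_of f \<subseteq> U" "\<And>t. t \<in> U \<Longrightarrow> fourier phi t = 0"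
  shows "(LINT x|lborel. f x * phi x) = 0"
proof -
  define L where "L = \<bar>T\<bar> + 1"
  define r where "r = lattice_point (1 / (2 * L))"
  have "L > 0" by (simp add: L_def)
  obtain e where e: "0 < e" "e \<le> 1"
    and scale: "\<And>\<tau>. \<tau> \<in> {-L..L} \<Longrightarrow> cball \<tau> e \<subseteq> U \<or> (\<exists>S. annihilates S f \<and> S \<inter> cball \<tau> e = {})"
    by (rule uniform_scale_of_local_annihilation[OF U(1,2) compact_Icc]) (rule that)
  obtain b where b: "b \<in> bump e" "integral {-e..e} b = 1" using bump_exists[OF e(1)] by metis
  define a where "a j = fourier b (r j) * (LINT x|lborel. f x * phi (x + r j))" for j
  have "(\<Sum>j. a j * exp2pi (of_real (- (r j * \<tau>)))) = 0" if \<tau>: "\<tau> \<in> {-L..L}" for \<tau>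
  proof -
    interpret rapid_coefficients "window b L \<tau>" r
      unfolding r_def using b(1) e \<open>L > 0\<close> by (intro rapid_coefficients_window) auto
    have "(\<forall>t\<in>cball \<tau> e. fourier phi t = 0) \<or> (\<exists>S. annihilates S f \<and> S \<inter> cball \<tau> e = {})"
      using scale[OF \<tau>] U(3) by blast
    hence "(LINT x|lborel. f x * shift_series (window b L \<tau>) r phi x) = 0"
      unfolding r_def using e \<tau> \<open>L > 0\<close>
      by (intro windowed_pairing_eq_0[OF f phi band b(1)]) (auto simp: L_def)
    with integral_mult_shift_series(1)[OF f phi]
    have "(\<lambda>j. window b L \<tau> j * (LINT x|lborel. f x * phi (x + r j))) sums 0" by simp
    thus ?thesis by (simp add: sums_iff a_def window_def r_def mult_ac)
  qed
  moreover have "summable (\<lambda>j. norm (a j))"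
  proof -
    interpret rapid_coefficients "\<lambda>j. fourier b (r j)" r
      unfolding r_def using b(1) \<open>L > 0\<close> by (intro rapid_coefficients_fourier_bump_samples) auto
    show ?thesis unfolding a_def by (rule integral_mult_shift_series(2)[OF f phi])
  qed
  ultimately have "a 0 = 0"
    using \<open>L > 0\<close> trigonometric_series_coefficient_eq_0[of L a 0] by (simp add: r_def)
  thus ?thesis using b(2) by (simp add: a_def r_def fourier_bump_eq_interval_ft[OF b(1)] interval_ft_0)
qed

lemma (in rapid_coefficients) shift_series_eq_0_of_symbol_eq_0:
  assumes f: "f \<in> poly_growth_space" and U: "open U" "spectrum_of f \<subseteq> U" "\<And>t. t \<in> U \<Longrightarrow> symbol c r t = 0"
  shows "shift_series c (\<lambda>j. - r j) f x = 0"
proof (rule poly_growth_eq_0_of_band_limited_pairings)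
  show "shift_series c (\<lambda>j. - r j) f \<in> poly_growth_space"
    by (rule rapid_coefficients.shift_series_in_poly_growth_space[OF rapid_coefficients_uminus f])
  fix phi T assume phi: "schwartz phi" and "\<And>t. T \<le> \<bar>t\<bar> \<Longrightarrow> fourier phi t = 0"
  thus "(LINT y|lborel. shift_series c (\<lambda>j. - r j) f y * phi y) = 0"
    unfolding integral_shift_series_mult[OF f phi]
    by (intro integral_eq_0_of_fourier_eq_0_near_spectrum[OF f schwartz_shift_series[OF phi] _ U(1,2)])
       (auto simp: fourier_shift_series[OF phi] U(3))
qed

section \<open>Interpolation by entire functions\<close>

text \<open>
  With the pairing used to define the spectrum, \<open>x \<mapsto> exp (2 \<pi> i s x)\<close> has spectrum \<open>{- s}\<close>; hence the sign in
  the exponentials defining the kernel.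
\<close>

definition band_kernel :: "real \<Rightarrow> (real \<Rightarrow> complex) \<Rightarrow> real \<Rightarrow> real \<Rightarrow> complex \<Rightarrow> complex" where
  "band_kernel e b p q z = interval_ft (-e) e b z * interval_ft p q (\<lambda>_. 1) z"

lemma holomorphic_band_kernel: "b \<in> bump e \<Longrightarrow> band_kernel e b p q holomorphic_on S"
  unfolding band_kernel_def[abs_def]
  by (intro holomorphic_on_mult holomorphic_interval_ft continuous_on_const bump_continuous_on)

lemma band_kernel_decay:
  assumes b: "b \<in> bump e" "e \<ge> 0" and "p \<le> q"
  shows "\<exists>C. \<forall>z. norm (band_kernel e b p q z) * (1 + norm z) ^ k
    \<le> C * exp (pi * ((p + q) * Im z + (q - p + 2 * e) * \<bar>Im z\<bar>))"
proof -
  obtain C where "C \<ge> 0"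
    and bump_le: "norm (interval_ft (-e) e b z) * (1 + norm z) ^ k \<le> C * exp (2 * pi * e * \<bar>Im z\<bar>)" for z
    using interval_ft_bump_decay[OF b] by blast
  have "norm (band_kernel e b p q z) * (1 + norm z) ^ k
      \<le> C * (q - p) * exp (pi * ((p + q) * Im z + (q - p + 2 * e) * \<bar>Im z\<bar>))" for z
  proof -
    have "norm (band_kernel e b p q z) * (1 + norm z) ^ k
        = (norm (interval_ft (-e) e b z) * (1 + norm z) ^ k) * norm (interval_ft p q (\<lambda>_. 1) z)"
      unfolding band_kernel_def norm_mult by (simp only: mult_ac)
    also have "\<dots> \<le> (C * exp (2 * pi * e * \<bar>Im z\<bar>)) * (1 * (q - p) * exp (pi * ((p + q) * Im z + (q - p) * \<bar>Im z\<bar>)))"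
      using \<open>C \<ge> 0\<close> \<open>p \<le> q\<close> by (intro mult_mono bump_le norm_interval_ft_le) auto
    also have "\<dots> = C * (q - p) * exp (pi * ((p + q) * Im z + (q - p + 2 * e) * \<bar>Im z\<bar>))"
      by (simp add: algebra_simps flip: exp_add)
    finally show ?thesis .
  qed
  thus ?thesis by blast
qed

lemma distance_to_integers_in_gap:
  fixes p q e t u :: real
  assumes "p + e + of_int k < t" "t < q - e + of_int k" and "q \<le> u" "u \<le> p + 1"
  shows "e < \<bar>t - u - of_int m\<bar>"
proof (cases "k \<le> m")
  case True
  hence "real_of_int k \<le> of_int m" by simp
  thus ?thesis using assms by linarith
next
  case False
  hence "real_of_int m + 1 \<le> of_int k" by linarith
  thus ?thesis using assms by linarith
qed

lemma symbol_complementary_samples_eq_0: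
  assumes b: "b \<in> bump e" and t: "t \<in> (\<Union>k::int. {p + e + of_int k<..<q - e + of_int k})"
  shows "symbol (\<lambda>j. fourier b (lattice_point 1 j) * interval_ft q (p + 1) (\<lambda>_. 1) (of_real (lattice_point 1 j)))
    (lattice_point 1) t = 0"
proof -
  define g where "g j u = fourier b (lattice_point 1 j) * exp2pi (of_real (lattice_point 1 j * (t - u)))" for j u
  interpret rapid_coefficients "\<lambda>j. fourier b (lattice_point 1 j)" "lattice_point 1"
    by (rule rapid_coefficients_fourier_bump_samples[OF b]) simp
  obtain k :: int where k: "p + e + of_int k < t" "t < q - e + of_int k" using t by auto
  have "(\<Sum>j. g j u) = 0" if "u \<in> {q..p + 1}" for u
  proof -
    have "symbol (\<lambda>j. fourier b (lattice_point 1 j)) (lattice_point 1) (t - u) = 0"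
      using distance_to_integers_in_gap[OF k] that by (intro symbol_fourier_bump_samples_eq_0[OF b]) simp_all
    thus ?thesis by (simp add: symbol_def g_def)
  qed
  hence "integral {q..p + 1} (\<lambda>u. \<Sum>j. g j u) = 0"
    by (subst Henstock_Kurzweil_Integration.integral_cong[of _ _ "\<lambda>_. 0"]) auto
  moreover have "(\<lambda>j. integral {q..p + 1} (g j)) sums integral {q..p + 1} (\<lambda>u. \<Sum>j. g j u)"
  proof (rule sums_interval_integral)
    show "continuous_on {q..p + 1} (g j)" for j unfolding g_def by (intro continuous_intros)
    show "norm (g j u) \<le> norm (fourier b (lattice_point 1 j))" for j u
      unfolding g_def norm_mult norm_exp2pi_of_real by simp
    show "summable (\<lambda>j. norm (fourier b (lattice_point 1 j)))" using summable_weighted[of 0] by simp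
  qed
  moreover have "integral {q..p + 1} (g j) = fourier b (lattice_point 1 j)
      * interval_ft q (p + 1) (\<lambda>_. 1) (of_real (lattice_point 1 j)) * exp2pi (of_real (lattice_point 1 j * t))" for j
  proof -
    have "g j = (\<lambda>u. fourier b (lattice_point 1 j) * exp2pi (of_real (lattice_point 1 j * t))
        * (1 * exp2pi (- (of_real (lattice_point 1 j) * of_real u))))"
      by (simp add: g_def[abs_def] mult.assoc right_diff_distrib flip: exp2pi_add)
    thus ?thesis by (simp add: interval_ft_def mult_ac)
  qed
  ultimately show ?thesis by (simp add: symbol_def sums_iff)
qed

lemma band_kernel_plus_complementary:
  assumes b: "b \<in> bump e" "integral {-e..e} b = 1" and pq: "p \<le> q" "q \<le> p + 1"
  shows "band_kernel e b p q (of_int n) + fourier b (of_int n) * interval_ft q (p + 1) (\<lambda>_. 1) (of_int n)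
    = (if n = 0 then 1 else 0)"
proof -
  have "interval_ft p q (\<lambda>_. 1) (of_int n) + interval_ft q (p + 1) (\<lambda>_. 1) (of_int n)
      = interval_ft p (p + 1) (\<lambda>_. 1) (of_int n / of_real (p + 1 - p))"
    using pq by (simp add: interval_ft_combine)
  also have "\<dots> = (if n = 0 then 1 else 0)"
    by (subst interval_ft_1_of_int) auto
  finally have "band_kernel e b p q (of_int n) + fourier b (of_int n) * interval_ft q (p + 1) (\<lambda>_. 1) (of_int n)
      = fourier b (of_int n) * (if n = 0 then 1 else 0)"
    by (simp add: band_kernel_def fourier_bump_eq_interval_ft[OF b(1)] flip: distrib_left)
  also have "\<dots> = (if n = 0 then 1 else 0)"
    using b by (simp add: fourier_bump_eq_interval_ft interval_ft_0)
  finally show ?thesis .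
qed

lemma band_kernel_reproduces:
  assumes b: "b \<in> bump e" "integral {-e..e} b = 1" and pq: "p \<le> q" "q \<le> p + 1"
    and f: "f \<in> poly_growth_space" "spectrum_of f \<subseteq> (\<Union>k::int. {p + e + of_int k<..<q - e + of_int k})"
  shows "(\<lambda>j. band_kernel e b p q (of_int (int_decode j)) * f (x - of_int (int_decode j))) sums f x"
proof -
  define n where "n = lattice_point 1"
  define d where "d j = fourier b (n j) * interval_ft q (p + 1) (\<lambda>_. 1) (of_real (n j))" for j
  have n: "n j = of_int (int_decode j)" for j by (simp add: n_def lattice_point_def)
  have "norm (interval_ft q (p + 1) (\<lambda>_. 1) (of_real (n j))) \<le> 1" for j
    using norm_interval_ft_le[of q "p + 1" "\<lambda>_. 1" 1 "of_real (n j)"] pq by simp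
  then interpret d: rapid_coefficients d n
    unfolding d_def[abs_def] n_def
    by (intro rapid_coefficients_lattice_samples rapidly_decreasing_fourier_bump[OF b(1)]) auto
  have "shift_series d (\<lambda>j. - n j) f x = 0"
  proof (rule d.shift_series_eq_0_of_symbol_eq_0[OF f(1) _ f(2)])
    show "symbol d n t = 0" if "t \<in> (\<Union>k::int. {p + e + of_int k<..<q - e + of_int k})" for t
      unfolding d_def[abs_def] n_def by (rule symbol_complementary_samples_eq_0[OF b(1) that])
  qed auto
  moreover have "summable (\<lambda>j. d j * f (x + - n j))"
    by (rule rapid_coefficients.summable_mult_shift[OF d.rapid_coefficients_uminus f(1)])
  ultimately have "(\<lambda>j. d j * f (x + - n j)) sums 0"
    by (simp add: shift_series_def sums_iff)
  from sums_diff[OF sums_single[of 0 "\<lambda>_. f x"] this]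
  have "(\<lambda>j. (if j = 0 then f x else 0) - d j * f (x + - n j)) sums f x" by simp
  moreover have "(if j = 0 then f x else 0) - d j * f (x + - n j)
      = band_kernel e b p q (of_int (int_decode j)) * f (x - of_int (int_decode j))" for j
  proof -
    have "int_decode j = 0 \<longleftrightarrow> j = 0"
      by (metis int_decode_inverse lattice_point_0 lattice_point_def mult_1 of_int_eq_0_iff)
    hence "band_kernel e b p q (of_int (int_decode j)) = (if j = 0 then 1 else 0) - d j"
      using band_kernel_plus_complementary[OF b pq, of "int_decode j"] by (simp add: d_def n eq_diff_eq)
    thus ?thesis by (auto simp: n left_diff_distrib int_decode_def sum_decode_def)
  qed
  ultimately show ?thesis by simp
qed

subsection \<open>Cardinal series\<close>

definition cardinal_series :: "(int \<Rightarrow> complex) \<Rightarrow> (complex \<Rightarrow> complex) \<Rightarrow> complex \<Rightarrow> complex" where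
  "cardinal_series a K z = (\<Sum>j. a (int_decode j) * K (z - of_int (int_decode j)))"

locale cardinal_series_convergence =
  fixes a :: "int \<Rightarrow> complex" and K :: "complex \<Rightarrow> complex" and A :: real and N :: nat and E :: "real \<Rightarrow> real"
  assumes a_growth: "norm (a n) \<le> A * (1 + \<bar>of_int n\<bar>) ^ N"
    and K_decay: "norm (K z) * (1 + norm z) ^ (N + 2) \<le> E (Im z)"
    and K_holomorphic: "K holomorphic_on UNIV" and E_continuous: "continuous_on UNIV E"
begin

lemma norm_term_le:
  "norm (a n * K (z - of_int n)) \<le> A * (1 + norm z) ^ (N + 2) * E (Im z) * (1 / (1 + \<bar>of_int n\<bar>)\<^sup>2)"
proof -
  have "0 \<le> A" using order_trans[OF norm_ge_zero a_growth[of 0]] by simp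
  define w where "w = z - of_int n"
  have "1 + \<bar>real_of_int n\<bar> \<le> (1 + norm z) * (1 + norm w)"
    using one_plus_norm_add_le[of z "- w"] by (simp add: w_def norm_minus_commute)
  hence "(1 + \<bar>real_of_int n\<bar>) ^ (N + 2) \<le> ((1 + norm z) * (1 + norm w)) ^ (N + 2)"
    by (rule power_mono) simp
  hence "norm (K w) * (1 + \<bar>real_of_int n\<bar>) ^ (N + 2) \<le> norm (K w) * ((1 + norm z) * (1 + norm w)) ^ (N + 2)"
    by (rule mult_left_mono) simp
  also have "\<dots> = (1 + norm z) ^ (N + 2) * (norm (K w) * (1 + norm w) ^ (N + 2))"
    unfolding power_mult_distrib by (simp only: mult_ac)
  also have "\<dots> \<le> (1 + norm z) ^ (N + 2) * E (Im z)"
    using K_decay[of w] by (intro mult_left_mono) (auto simp: w_def)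
  finally have K_le: "norm (K w) * (1 + \<bar>real_of_int n\<bar>) ^ (N + 2) \<le> (1 + norm z) ^ (N + 2) * E (Im z)" .
  have "norm (a n * K w) * (1 + \<bar>real_of_int n\<bar>)\<^sup>2
      \<le> A * (1 + \<bar>of_int n\<bar>) ^ N * norm (K w) * (1 + \<bar>real_of_int n\<bar>)\<^sup>2"
    unfolding norm_mult by (intro mult_right_mono a_growth) auto
  also have "\<dots> = A * (norm (K w) * (1 + \<bar>real_of_int n\<bar>) ^ (N + 2))"
    by (simp only: power_add mult_ac)
  also have "\<dots> \<le> A * ((1 + norm z) ^ (N + 2) * E (Im z))" by (rule mult_left_mono[OF K_le \<open>0 \<le> A\<close>])
  finally show ?thesis by (simp add: w_def pos_le_divide_eq mult.assoc)
qed

lemma summable_weights: "summable (\<lambda>j. 1 / (1 + \<bar>real_of_int (int_decode j)\<bar>)\<^sup>2)"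
  using summable_lattice_inverse_square[of 1] by (simp add: lattice_point_def)

lemma summable_terms: "summable (\<lambda>j. norm (a (int_decode j) * K (z - of_int (int_decode j))))"
  by (rule summable_comparison_test'[OF summable_mult[OF summable_weights,
        of "A * (1 + norm z) ^ (N + 2) * E (Im z)"]])
     (simp only: real_norm_def abs_norm_cancel norm_term_le)

lemma norm_cardinal_series_le:
  "norm (cardinal_series a K z)
    \<le> A * (1 + norm z) ^ (N + 2) * E (Im z) * (\<Sum>j. 1 / (1 + \<bar>real_of_int (int_decode j)\<bar>)\<^sup>2)"
  unfolding cardinal_series_def suminf_mult[OF summable_weights, symmetric]
  by (intro norm_suminf_le norm_term_le summable_mult summable_weights)

lemma holomorphic_cardinal_series: "cardinal_series a K holomorphic_on UNIV"
proof (rule holomorphic_uniform_sequence)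
  show "(\<lambda>z. \<Sum>j<k. a (int_decode j) * K (z - of_int (int_decode j))) holomorphic_on UNIV" for k
    by (intro holomorphic_intros holomorphic_on_compose_gen[OF _ K_holomorphic, unfolded o_def]) auto
  fix z :: complex
  have "continuous_on (cball z 1) (\<lambda>w. A * (1 + norm w) ^ (N + 2) * E (Im w))"
    by (intro continuous_intros continuous_on_compose2[OF E_continuous]) auto
  then obtain M where bound_le: "\<And>w. w \<in> cball z 1 \<Longrightarrow> A * (1 + norm w) ^ (N + 2) * E (Im w) \<le> M"
    using continuous_attains_sup[of "cball z 1" "\<lambda>w. A * (1 + norm w) ^ (N + 2) * E (Im w)"] by force
  have "norm (a n * K (w - of_int n)) \<le> M * (1 / (1 + \<bar>of_int n\<bar>)\<^sup>2)" if "w \<in> cball z 1" for n w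
    using norm_term_le[of n w] mult_right_mono[OF bound_le[OF that], of "1 / (1 + \<bar>of_int n\<bar>)\<^sup>2"] by simp
  hence "uniform_limit (cball z 1) (\<lambda>k w. \<Sum>j<k. a (int_decode j) * K (w - of_int (int_decode j)))
      (cardinal_series a K) sequentially"
    unfolding cardinal_series_def[abs_def]
    by (rule Weierstrass_m_test[OF _ summable_mult[OF summable_weights, of M]])
  thus "\<exists>d>0. cball z d \<subseteq> UNIV \<and> uniform_limit (cball z d)
      (\<lambda>k w. \<Sum>j<k. a (int_decode j) * K (w - of_int (int_decode j))) (cardinal_series a K) sequentially"
    by (intro exI[of _ 1]) auto
qed simp

end

lemma sums_int_decode_reflect:
  fixes a :: "int \<Rightarrow> 'a :: banach"
  assumes "summable (\<lambda>j. norm (a (int_decode j)))"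
  shows "(\<lambda>j. a (m - int_decode j)) sums (\<Sum>j. a (int_decode j))"
proof -
  have "((\<lambda>j. a (int_decode j)) has_sum (\<Sum>j. a (int_decode j))) UNIV"
    using assms summable_norm_cancel[OF assms] by (intro norm_summable_imp_has_sum) (auto simp: summable_sums)
  hence "(a has_sum (\<Sum>j. a (int_decode j))) UNIV"
    by (subst (asm) has_sum_reindex_bij_betw[OF bij_int_decode])
  moreover have "bij_betw (\<lambda>n. m - n) UNIV (UNIV :: int set)"
    by (rule bij_betw_byWitness[of _ "\<lambda>n. m - n"]) auto
  ultimately have "((\<lambda>n. a (m - n)) has_sum (\<Sum>j. a (int_decode j))) UNIV"
    by (subst has_sum_reindex_bij_betw)
  hence "((\<lambda>j. a (m - int_decode j)) has_sum (\<Sum>j. a (int_decode j))) UNIV"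
    by (subst has_sum_reindex_bij_betw[OF bij_int_decode, of "\<lambda>n. a (m - n)"])
  thus ?thesis by (rule has_sum_imp_sums)
qed

lemma (in cardinal_series_convergence) cardinal_series_of_int:
  "(\<lambda>j. K (of_int (int_decode j)) * a (m - int_decode j)) sums cardinal_series a K (of_int m)"
  using sums_int_decode_reflect[OF summable_terms[of "of_int m"], of m]
  by (simp add: cardinal_series_def mult.commute)

lemma entire_interpolant_of_band:
  assumes f: "f \<in> poly_growth_space" "spectrum_of f \<subseteq> (\<Union>k::int. {p + e + of_int k<..<q - e + of_int k})"
    and "e > 0" and pq: "p \<le> q" "q \<le> p + 1"
  obtains F C N where "F holomorphic_on UNIV"
    "\<And>z. norm (F z) \<le> C * (1 + norm z) ^ N * exp (pi * ((p + q) * Im z + (q - p + 2 * e) * \<bar>Im z\<bar>))"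
    "\<And>m::int. F (of_int m) = f (of_int m + s)"
proof -
  obtain b where b: "b \<in> bump e" "integral {-e..e} b = 1" using bump_exists[OF \<open>e > 0\<close>] by metis
  obtain A N where "A \<ge> 0" and f_le: "\<And>x. norm (f x) \<le> A * (1 + \<bar>x\<bar>) ^ N" using poly_growthE[OF f(1)] by blast
  define E where "E y = exp (pi * ((p + q) * y + (q - p + 2 * e) * \<bar>y\<bar>))" for y
  obtain C where kernel_le: "\<And>z. norm (band_kernel e b p q z) * (1 + norm z) ^ (N + 2) \<le> C * E (Im z)"
    using band_kernel_decay[OF b(1) _ pq(1), of "N + 2"] \<open>e > 0\<close> unfolding E_def by (metis less_imp_le)
  define a where "a n = f (of_int n + s)" for n
  interpret cardinal_series_convergence a "band_kernel e b p q" "A * (1 + \<bar>s\<bar>) ^ N" N "\<lambda>y. C * E y"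
  proof
    fix n
    have "norm (a n) \<le> A * ((1 + \<bar>s\<bar>) * (1 + \<bar>of_int n\<bar>)) ^ N"
      unfolding a_def using one_plus_norm_add_le[of s "of_int n"] \<open>A \<ge> 0\<close>
      by (intro order_trans[OF f_le] mult_left_mono power_mono) (auto simp: add.commute)
    thus "norm (a n) \<le> A * (1 + \<bar>s\<bar>) ^ N * (1 + \<bar>of_int n\<bar>) ^ N"
      by (simp add: power_mult_distrib mult.assoc)
  next
    show "continuous_on UNIV (\<lambda>y. C * E y)" unfolding E_def by (intro continuous_intros)
  qed (use kernel_le holomorphic_band_kernel[OF b(1)] in auto)
  let ?F = "cardinal_series a (band_kernel e b p q)"
  show thesis
  proof (rule that[OF holomorphic_cardinal_series])
    let ?Q = "\<Sum>j. 1 / (1 + \<bar>real_of_int (int_decode j)\<bar>)\<^sup>2"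
    show "norm (?F z) \<le> A * (1 + \<bar>s\<bar>) ^ N * C * ?Q * (1 + norm z) ^ (N + 2)
        * exp (pi * ((p + q) * Im z + (q - p + 2 * e) * \<bar>Im z\<bar>))" for z
      using norm_cardinal_series_le[of z] by (simp only: E_def mult_ac)
    fix m
    have "(\<lambda>j. band_kernel e b p q (of_int (int_decode j)) * f (of_int m + s - of_int (int_decode j)))
        sums f (of_int m + s)"
      using b pq \<open>e > 0\<close> by (intro band_kernel_reproduces f) auto
    moreover have "f (of_int m + s - of_int (int_decode j)) = a (m - int_decode j)" for j
      by (simp add: a_def algebra_simps)
    ultimately show "?F (of_int m) = f (of_int m + s)"
      using cardinal_series_of_int[of m] sums_unique2 by simp
  qed
qed

lemma spectrum_subset_open_bands:
  assumes "f \<in> X_S {u + real_of_int k | u k. u \<in> {\<alpha>..\<beta>}}" "e > 0"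
  shows "spectrum_of f \<subseteq> (\<Union>k::int. {\<alpha> - e + of_int k<..<\<beta> + e + of_int k})"
proof
  fix x assume "x \<in> spectrum_of f"
  with assms(1) obtain u k where "x = u + real_of_int k" "u \<in> {\<alpha>..\<beta>}" by (auto simp: X_S_def)
  hence "x \<in> {\<alpha> - e + of_int k<..<\<beta> + e + of_int k}" using \<open>e > 0\<close> by simp
  thus "x \<in> (\<Union>k::int. {\<alpha> - e + of_int k<..<\<beta> + e + of_int k})" by blast
qed

lemma entire_interpolant:
  assumes "\<alpha> \<le> \<beta>" "\<beta> < \<alpha> + 1" and f: "f \<in> X_S {u + real_of_int k | u k. u \<in> {\<alpha>..\<beta>}}"
  obtains G c C N where "c > 0" "G holomorphic_on UNIV"
    "\<And>z. norm (G z) \<le> C * (1 + norm z) ^ N * exp ((pi - c) * \<bar>Im z\<bar>)"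
    "\<And>m::int. G (of_int m) = 0 \<longleftrightarrow> f (of_int m + s) = 0"
proof -
  define e where "e = (\<alpha> + 1 - \<beta>) / 8"
  define p q where "p = \<alpha> - 2 * e" and "q = \<beta> + 2 * e"
  have "e > 0" "p \<le> q" "q \<le> p + 1" using assms(1,2) by (simp_all add: e_def p_def q_def field_simps)
  have spectrum: "spectrum_of f \<subseteq> (\<Union>k::int. {p + e + of_int k<..<q - e + of_int k})"
    using spectrum_subset_open_bands[OF f \<open>e > 0\<close>] by (simp add: p_def q_def add.commute)
  have "f \<in> poly_growth_space" using f by (simp add: X_S_def)
  then obtain F C N where F_holomorphic: "F holomorphic_on UNIV"
    and F_le: "\<And>z. norm (F z) \<le> C * (1 + norm z) ^ N * exp (pi * ((p + q) * Im z + (q - p + 2 * e) * \<bar>Im z\<bar>))"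
    and F_of_int: "\<And>m::int. F (of_int m) = f (of_int m + s)"
    by (rule entire_interpolant_of_band[OF _ spectrum \<open>e > 0\<close> \<open>p \<le> q\<close> \<open>q \<le> p + 1\<close>, of s]) (rule that)
  define G where "G z = exp2pi (of_real ((p + q) / 2) * z) * F z" for z
  show thesis
  proof (rule that)
    show "2 * pi * e > 0" using \<open>e > 0\<close> by simp
    show "G holomorphic_on UNIV"
      unfolding G_def by (intro holomorphic_intros F_holomorphic)
    show "G (of_int m) = 0 \<longleftrightarrow> f (of_int m + s) = 0" for m
      by (simp add: G_def F_of_int exp2pi_def)
    fix z
    have "norm (G z) = exp (- pi * (p + q) * Im z) * norm (F z)"
      by (simp add: G_def norm_mult norm_exp2pi)
    also have "\<dots> \<le> exp (- pi * (p + q) * Im z)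
        * (C * (1 + norm z) ^ N * exp (pi * ((p + q) * Im z + (q - p + 2 * e) * \<bar>Im z\<bar>)))"
      by (intro mult_left_mono F_le) simp
    also have "\<dots> = C * (1 + norm z) ^ N
        * exp (- pi * (p + q) * Im z + pi * ((p + q) * Im z + (q - p + 2 * e) * \<bar>Im z\<bar>))"
      unfolding exp_add by (simp only: mult_ac)
    also have "- pi * (p + q) * Im z + pi * ((p + q) * Im z + (q - p + 2 * e) * \<bar>Im z\<bar>) = (pi - 2 * pi * e) * \<bar>Im z\<bar>"
      by (simp add: p_def q_def e_def field_simps)
    finally show "norm (G z) \<le> C * (1 + norm z) ^ N * exp ((pi - 2 * pi * e) * \<bar>Im z\<bar>)" .
  qed
qed

lemma eq_0_on_integer_translate_of_zeros_on_long_blocks: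
  assumes "\<alpha> \<le> \<beta>" "\<beta> < \<alpha> + 1" and f: "f \<in> X_S {u + real_of_int k | u k. u \<in> {\<alpha>..\<beta>}}"
    and zeros: "\<exists>\<^sub>\<infinity>a::nat. \<forall>n::int. int a \<le> \<bar>n\<bar> \<and> \<bar>n\<bar> < int (a\<^sup>2) \<longrightarrow> f (of_int n + s) = 0"
  shows "f (of_int m + s) = 0"
proof -
  obtain G c C N where "c > 0" "G holomorphic_on UNIV"
    "\<And>z. norm (G z) \<le> C * (1 + norm z) ^ N * exp ((pi - c) * \<bar>Im z\<bar>)"
    and G: "\<And>m::int. G (of_int m) = 0 \<longleftrightarrow> f (of_int m + s) = 0"
    by (rule entire_interpolant[OF assms(1-3), of s]) (rule that)
  with zeros have "G (of_int m) = 0"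
    by (intro entire_eq_0_of_zeros_on_long_blocks[of G c C N]) auto
  thus ?thesis using G by simp
qed

section \<open>The sampling set\<close>

lemma card_points_in_unit_cells:
  fixes p :: "int \<Rightarrow> real"
  assumes p: "\<And>n. of_int n \<le> p n" "\<And>n. p n < of_int n + 1" and "0 < r"
  shows "finite {n. p n \<in> {x<..<x + r}}" "\<bar>real (card {n. p n \<in> {x<..<x + r}}) - r\<bar> \<le> 2"
proof -
  define I where "I = {n. p n \<in> {x<..<x + r}}"
  have upper: "I \<subseteq> {\<lfloor>x\<rfloor>..\<lceil>x + r\<rceil> - 1}"
  proof
    fix n assume "n \<in> I"
    hence "x < of_int n + 1" "of_int n < x + r" using p[of n] by (auto simp: I_def)
    thus "n \<in> {\<lfloor>x\<rfloor>..\<lceil>x + r\<rceil> - 1}" by (simp, linarith)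
  qed
  have lower: "{\<lfloor>x\<rfloor> + 1..\<lfloor>x + r\<rfloor> - 1} \<subseteq> I"
  proof
    fix n assume "n \<in> {\<lfloor>x\<rfloor> + 1..\<lfloor>x + r\<rfloor> - 1}"
    hence "x < of_int n" "of_int n + 1 \<le> x + r" by (simp_all, linarith+)
    thus "n \<in> I" using p[of n] by (auto simp: I_def)
  qed
  have "finite I" using upper by (rule finite_subset) simp
  have "card I \<le> nat (\<lceil>x + r\<rceil> - \<lfloor>x\<rfloor>)" using card_mono[OF _ upper] by simp
  moreover have "nat (\<lfloor>x + r\<rfloor> - 1 - \<lfloor>x\<rfloor>) \<le> card I" using card_mono[OF \<open>finite I\<close> lower] by simp
  ultimately have "real (card I) \<le> r + 2" "real (card I) \<ge> r - 2" using \<open>0 < r\<close> by linarith+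
  thus "finite {n. p n \<in> {x<..<x + r}}" "\<bar>real (card {n. p n \<in> {x<..<x + r}}) - r\<bar> \<le> 2"
    unfolding I_def[symmetric] using \<open>finite I\<close> by auto
qed

lemma uniform_density_of_points_in_unit_cells:
  fixes p :: "int \<Rightarrow> real"
  assumes p: "\<And>n. of_int n \<le> p n" "\<And>n. p n < of_int n + 1"
  shows "has_uniform_density (range p) 1"
  unfolding has_uniform_density_def
proof (intro allI impI)
  have "inj p"
  proof (rule linorder_injI)
    fix m n :: int assume "m < n"
    hence "real_of_int m + 1 \<le> of_int n" by linarith
    thus "p m \<noteq> p n" using p(2)[of m] p(1)[of n] by linarith
  qed
  fix e :: real assume "e > 0"
  show "\<exists>R. \<forall>r\<ge>R. \<forall>x. finite (range p \<inter> {x<..<x + r}) \<and>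
      \<bar>real (card (range p \<inter> {x<..<x + r})) - r * 1\<bar> \<le> e * r"
  proof (intro exI[of _ "2 / e"] allI impI)
    fix r x :: real assume r: "r \<ge> 2 / e"
    have "0 < r" using r \<open>e > 0\<close> by (meson divide_pos_pos less_le_trans zero_less_numeral)
    note card_points = card_points_in_unit_cells[OF p \<open>0 < r\<close>, of x]
    have "range p \<inter> {x<..<x + r} = p ` {n. p n \<in> {x<..<x + r}}" by auto
    moreover have "card (p ` {n. p n \<in> {x<..<x + r}}) = card {n. p n \<in> {x<..<x + r}}"
      by (rule card_image[OF inj_on_subset[OF \<open>inj p\<close> subset_UNIV]])
    moreover have "2 \<le> e * r" using r \<open>e > 0\<close> by (simp add: field_simps)
    ultimately show "finite (range p \<inter> {x<..<x + r}) \<and> \<bar>real (card (range p \<inter> {x<..<x + r})) - r * 1\<bar> \<le> e * r"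
      using card_points by simp
  qed
qed

definition rational_shift :: "nat \<Rightarrow> real" where
  "rational_shift = from_nat_into (\<rat> \<inter> {0..<1})"

text \<open>
  Inserting the shift \<open>1/2\<close> between any two others makes adjacent shifts differ by at most \<open>1/2\<close>, which keeps
  the shifted blocks separated.
\<close>

definition block_shift :: "nat \<Rightarrow> real" where
  "block_shift k = (if even k then rational_shift (fst (prod_decode (k div 2))) else 1 / 2)"

definition block :: "int \<Rightarrow> nat" where
  "block n = (LEAST k. \<bar>n\<bar> < 2 ^ 2 ^ Suc k)"

definition sample_point :: "int \<Rightarrow> real" where
  "sample_point n = of_int n + block_shift (block n)"

lemma range_rational_shift: "range rational_shift = \<rat> \<inter> {0..<1}"
  unfolding rational_shift_def
  by (rule range_from_nat_into) (auto intro: countable_subset[OF _ countable_rat] exI[of _ 0])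

lemma block_shift_bounds: "0 \<le> block_shift k" "block_shift k < 1"
  using range_rational_shift by (auto simp: block_shift_def set_eq_iff image_iff)

lemma block_shift_adjacent:
  assumes "i \<le> Suc j" "j \<le> Suc i"
  shows "\<bar>block_shift i - block_shift j\<bar> \<le> 1 / 2"
proof (cases "i = j")
  case False
  hence "even i \<noteq> even j" using assms by (cases "i < j") (auto simp: le_Suc_eq)
  hence "block_shift i = 1 / 2 \<or> block_shift j = 1 / 2" by (auto simp: block_shift_def)
  thus ?thesis using block_shift_bounds[of i] block_shift_bounds[of j]
    by (elim disjE) (auto simp: abs_if)
qed simp

lemma block_less: "\<bar>n\<bar> < 2 ^ 2 ^ Suc (block n)"
proof -
  have "nat \<bar>n\<bar> < 2 ^ nat \<bar>n\<bar>" by (rule less_exp)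
  also have "\<dots> \<le> 2 ^ 2 ^ Suc (nat \<bar>n\<bar>)"
    by (intro power_increasing) (auto intro: order_trans[OF less_imp_le[OF less_exp]])
  finally have "int (nat \<bar>n\<bar>) < int (2 ^ 2 ^ Suc (nat \<bar>n\<bar>))" by (simp only: of_nat_less_iff)
  hence "\<bar>n\<bar> < 2 ^ 2 ^ Suc (nat \<bar>n\<bar>)" by simp
  thus ?thesis unfolding block_def by (rule LeastI)
qed

lemma block_le: "\<bar>n\<bar> < 2 ^ 2 ^ Suc k \<Longrightarrow> block n \<le> k"
  unfolding block_def by (rule Least_le)

lemma block_eqI:
  assumes "2 ^ 2 ^ k \<le> \<bar>n\<bar>" "\<bar>n\<bar> < 2 ^ 2 ^ Suc k"
  shows "block n = k"
proof (rule antisym)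
  show "block n \<le> k" using assms(2) by (rule block_le)
  show "k \<le> block n"
  proof (rule ccontr)
    assume "\<not> k \<le> block n"
    hence "(2::int) ^ 2 ^ Suc (block n) \<le> 2 ^ 2 ^ k" by (intro power_increasing) auto
    thus False using assms(1) block_less[of n] by linarith
  qed
qed

lemma block_le_Suc:
  assumes "\<bar>m\<bar> \<le> \<bar>n\<bar> + 1"
  shows "block m \<le> Suc (block n)"
proof (rule block_le)
  have "\<bar>m\<bar> \<le> 2 ^ 2 ^ Suc (block n)" using assms block_less[of n] by linarith
  also have "(2::int) ^ 2 ^ Suc (block n) < 2 ^ 2 ^ Suc (Suc (block n))"
    by (intro power_strict_increasing) auto
  finally show "\<bar>m\<bar> < 2 ^ 2 ^ Suc (Suc (block n))" .
qed

lemma sample_point_separated: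
  assumes "m < n"
  shows "sample_point m + 1 / 2 \<le> sample_point n"
proof (cases "n = m + 1")
  case True
  have "\<bar>block_shift (block m) - block_shift (block n)\<bar> \<le> 1 / 2"
    using True by (intro block_shift_adjacent block_le_Suc) auto
  thus ?thesis using True unfolding sample_point_def abs_le_iff by simp
next
  case False
  hence "real_of_int m + 2 \<le> real_of_int n" using assms by linarith
  thus ?thesis using block_shift_bounds[of "block m"] block_shift_bounds[of "block n"]
    unfolding sample_point_def by linarith
qed

lemma uniformly_discrete_sample_points: "uniformly_discrete (range sample_point)"
proof -
  have "1 / 2 \<le> \<bar>sample_point m - sample_point n\<bar>" if "sample_point m \<noteq> sample_point n" for m n
    using that sample_point_separated[of m n] sample_point_separated[of n m] by (cases m n rule: linorder_cases) auto
  thus ?thesis unfolding uniformly_discrete_def by (intro exI[of _ "1 / 2"]) auto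
qed

lemma uniform_density_sample_points: "has_uniform_density (range sample_point) 1"
  using block_shift_bounds by (intro uniform_density_of_points_in_unit_cells) (auto simp: sample_point_def)

lemma sample_points_contain_shifted_blocks:
  "\<exists>\<^sub>\<infinity>a::nat. \<forall>n::int. int a \<le> \<bar>n\<bar> \<and> \<bar>n\<bar> < int (a\<^sup>2) \<longrightarrow> sample_point n = of_int n + rational_shift j"
  unfolding INFM_nat_le
proof
  fix i :: nat
  define k where "k = 2 * prod_encode (j, i)"
  have "i \<le> prod_encode (j, i)" by (rule le_prod_encode_2)
  also have "\<dots> \<le> k" by (simp add: k_def)
  also have "k \<le> 2 ^ k" by (simp add: less_imp_le)
  also have "(2::nat) ^ k \<le> 2 ^ 2 ^ k" by (simp add: less_imp_le)
  finally have "i \<le> 2 ^ 2 ^ k" .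
  moreover have "sample_point n = of_int n + rational_shift j"
    if n: "int (2 ^ 2 ^ k) \<le> \<bar>n\<bar>" "\<bar>n\<bar> < int ((2 ^ 2 ^ k)\<^sup>2)" for n
  proof -
    have "block n = k"
      using n by (intro block_eqI) (simp_all add: power_mult[symmetric] mult.commute)
    thus ?thesis by (simp add: sample_point_def block_shift_def k_def)
  qed
  ultimately show "\<exists>a\<ge>i. \<forall>n::int. int a \<le> \<bar>n\<bar> \<and> \<bar>n\<bar> < int (a\<^sup>2) \<longrightarrow> sample_point n = of_int n + rational_shift j"
    by blast
qed

lemma eq_0_of_eq_0_on_rationals:
  fixes f :: "real \<Rightarrow> 'a :: {t1_space, zero}"
  assumes "continuous_on UNIV f" "\<And>x. x \<in> \<rat> \<Longrightarrow> f x = 0"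
  shows "f x = 0"
  using continuous_constant_on_closure[of "\<rat>" f 0 x] assms by (simp add: Rats_closure_real)

lemma uniqueness_set_sample_points:
  assumes "\<alpha> \<le> \<beta>" "\<beta> < \<alpha> + 1"
  shows "uniqueness_set (range sample_point) (X_S {u + real_of_int k | u k. u \<in> {\<alpha>..\<beta>}})"
  unfolding uniqueness_set_def
proof (intro ballI impI ext)
  fix f x
  assume f: "f \<in> X_S {u + real_of_int k | u k. u \<in> {\<alpha>..\<beta>}}" and zero: "\<forall>l\<in>range sample_point. f l = 0"
  have "f y = 0" if "y \<in> \<rat>" for y
  proof -
    have "frac y \<in> \<rat> \<inter> {0..<1}" using that by (auto simp: frac_def frac_lt_1[unfolded frac_def])
    then obtain j where j: "rational_shift j = frac y" using range_rational_shift by (metis imageE)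
    have "\<exists>\<^sub>\<infinity>a::nat. \<forall>n::int. int a \<le> \<bar>n\<bar> \<and> \<bar>n\<bar> < int (a\<^sup>2) \<longrightarrow> f (of_int n + rational_shift j) = 0"
      using sample_points_contain_shifted_blocks[of j] by (rule INFM_mono) (use zero in \<open>metis rangeI\<close>)
    hence "f (of_int \<lfloor>y\<rfloor> + rational_shift j) = 0"
      by (rule eq_0_on_integer_translate_of_zeros_on_long_blocks[OF assms f])
    thus ?thesis by (simp add: j frac_def)
  qed
  moreover have "continuous_on UNIV f" using f by (simp add: X_S_def poly_growth_space_def)
  ultimately show "f x = 0" by (rule eq_0_of_eq_0_on_rationals[rotated])
qed

theorem theorem5:
  shows "\<exists>L :: real set. uniformly_discrete L \<and> has_uniform_density L 1 \<and>
    (\<forall>\<delta>::real. 0 < \<delta> \<and> \<delta> < 1 \<longrightarrow>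
       uniqueness_set L (X_S {s + real_of_int k | s k. s \<in> {0..1 - \<delta>}}))"
proof (intro exI[of _ "range sample_point"] conjI allI impI)
  show "uniformly_discrete (range sample_point)" by (rule uniformly_discrete_sample_points)
  show "has_uniform_density (range sample_point) 1" by (rule uniform_density_sample_points)
  fix \<delta> :: real assume "0 < \<delta> \<and> \<delta> < 1"
  thus "uniqueness_set (range sample_point) (X_S {s + real_of_int k | s k. s \<in> {0..1 - \<delta>}})"
    by (intro uniqueness_set_sample_points) auto
qed

end
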